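(* Let $D=\{z\in\mathbb{C}:|z|<1\}$. If $\varphi$ is an elliptic automorphism of $D$ of order $3$ with fixed point $a\in D\setminus\{0\}$, then the composition operator $C_\varphi f=f\circ\varphi$ is not complex symmetric on the Hardy space $H^2(D)$.
   Context: $H^2(D)$ is the Hardy-Hilbert space of analytic functions $f$ on $D$ with $\|f\|^2=\sup_{0<r<1}\int_0^{2\pi}|f(re^{i\theta})|^2\frac{d\theta}{2\pi}<\infty$, with its usual inner product (for which $\{z^k\}_{k\ge0}$ is an orthonormal basis). For an analytic self-map $\varphi$ of $D$, $C_\varphi$ is bounded on $H^2(D)$. A conjugation on a complex Hilbert space $\mathcal{H}$ is a conjugate-linear, isometric map $C:\mathcal{H}\to\mathcal{H}$ with $C^2=I$. A bounded operator $T$ on $\mathcal{H}$ is complex symmetric if there exists a conjugation $C$ on $\mathcal{H}$ such that $T=CT^*C$. An automorphism of $D$ (a biholomorphic map of $D$ onto itself) is elliptic if it has a unique fixed point in $D$. The order of an elliptic automorphism $\varphi$ is the smallest positive integer $n$ such that the $n$-th iterate $\varphi\circ\cdots\circ\varphi$ is the identity on $D$, and is $\infty$ if no such $n$ exists. *)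

theory Defs
  imports "HOL-Complex_Analysis.Complex_Analysis" "HOL-Library.Extended_Nat"
begin

section \<open>Complex symmetric operators\<close>

text \<open>
  Complex inner product spaces are represented by a carrier \<open>H\<close> of complex-valued functions, with
  pointwise vector operations, and an inner product \<open>ip\<close> on \<open>H\<close> that is linear in its first and
  conjugate-linear in its second argument.  The notions below are meant for complete \<open>H\<close>.
\<close>

definition ip_norm :: "('v \<Rightarrow> 'v \<Rightarrow> complex) \<Rightarrow> 'v \<Rightarrow> real" where
  "ip_norm ip f = sqrt (Re (ip f f))"

definition conjugation_on ::
  "('a \<Rightarrow> complex) set \<Rightarrow> (('a \<Rightarrow> complex) \<Rightarrow> ('a \<Rightarrow> complex) \<Rightarrow> complex) \<Rightarrow>
    (('a \<Rightarrow> complex) \<Rightarrow> ('a \<Rightarrow> complex)) \<Rightarrow> bool" where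
  "conjugation_on H ip C \<longleftrightarrow>
     (\<forall>f\<in>H. C f \<in> H) \<and>
     (\<forall>f\<in>H. \<forall>g\<in>H. C (\<lambda>x. f x + g x) = (\<lambda>x. C f x + C g x)) \<and>
     (\<forall>c. \<forall>f\<in>H. C (\<lambda>x. c * f x) = (\<lambda>x. cnj c * C f x)) \<and>
     (\<forall>f\<in>H. ip_norm ip (C f) = ip_norm ip f) \<and>
     (\<forall>f\<in>H. C (C f) = f)"

text \<open>
  On a Hilbert space every bounded operator \<open>T\<close> has exactly one adjoint (as a function on \<open>H\<close>),
  and conversely an everywhere defined \<open>T\<close> with an everywhere defined adjoint is linear and bounded.
  Hence ``\<open>T = C T\<^sup>* C\<close>'' can be stated by naming the adjoint existentially, and this already
  includes the boundedness of \<open>T\<close>.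
\<close>

definition adjoint_on ::
  "'v set \<Rightarrow> ('v \<Rightarrow> 'v \<Rightarrow> complex) \<Rightarrow> ('v \<Rightarrow> 'v) \<Rightarrow> ('v \<Rightarrow> 'v) \<Rightarrow> bool" where
  "adjoint_on H ip T S \<longleftrightarrow>
     (\<forall>g\<in>H. S g \<in> H) \<and> (\<forall>f\<in>H. \<forall>g\<in>H. ip (T f) g = ip f (S g))"

definition complex_symmetric_on ::
  "('a \<Rightarrow> complex) set \<Rightarrow> (('a \<Rightarrow> complex) \<Rightarrow> ('a \<Rightarrow> complex) \<Rightarrow> complex) \<Rightarrow>
    (('a \<Rightarrow> complex) \<Rightarrow> ('a \<Rightarrow> complex)) \<Rightarrow> bool" where
  "complex_symmetric_on H ip T \<longleftrightarrow>
     (\<exists>C S. conjugation_on H ip C \<and> adjoint_on H ip T S \<and> (\<forall>f\<in>H. T f = C (S (C f))))"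


section \<open>The Hardy space\<close>

abbreviation unit_disc :: "complex set" where
  "unit_disc \<equiv> ball 0 1"

definition circle_mean :: "(complex \<Rightarrow> complex) \<Rightarrow> real \<Rightarrow> real" where
  "circle_mean f r = integral {0..2*pi} (\<lambda>t. (cmod (f (of_real r * cis t)))\<^sup>2) / (2*pi)"

text \<open>
  An analytic function on the disc is extended by \<open>0\<close> to the whole plane, so that equality in the
  Hardy space is equality of functions.
\<close>

definition hardy2 :: "(complex \<Rightarrow> complex) set" where
  "hardy2 = {f. f holomorphic_on unit_disc \<and> (\<forall>z. z \<notin> unit_disc \<longrightarrow> f z = 0) \<and>
                bdd_above (circle_mean f ` {0<..<1})}"

definition hardy_norm :: "(complex \<Rightarrow> complex) \<Rightarrow> real" where
  "hardy_norm f = sqrt (SUP r\<in>{0<..<1}. circle_mean f r)"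

definition taylor_coeff :: "(complex \<Rightarrow> complex) \<Rightarrow> nat \<Rightarrow> complex" where
  "taylor_coeff f k = (deriv ^^ k) f 0 / fact k"

text \<open>
  The inner product in which the monomials form an orthonormal basis; the last lemma of this section
  shows that it induces the norm above.
\<close>

definition hardy_inner :: "(complex \<Rightarrow> complex) \<Rightarrow> (complex \<Rightarrow> complex) \<Rightarrow> complex" where
  "hardy_inner f g = (\<Sum>k. taylor_coeff f k * cnj (taylor_coeff g k))"

definition composition_op :: "(complex \<Rightarrow> complex) \<Rightarrow> (complex \<Rightarrow> complex) \<Rightarrow> complex \<Rightarrow> complex" where
  "composition_op \<phi> f = (\<lambda>z. if z \<in> unit_disc then f (\<phi> z) else 0)"

lemma has_integral_cis_of_int:
  fixes m :: int
  shows "((\<lambda>t. cis (of_int m * t)) has_integral (if m = 0 then of_real (2*pi) else 0)) {0..2*pi}"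
proof (cases "m = 0")
  case True
  have "((\<lambda>t::real. 1::complex) has_integral (2*pi - 0) *\<^sub>R 1) {0..2*pi}"
    using has_integral_const_real[of "1::complex" 0 "2*pi"] by simp
  then show ?thesis using True by (simp add: scaleR_conv_of_real)
next
  case False
  let ?F = "\<lambda>t::real. cis (of_int m * t) / (\<i> * of_int m)"
  have "((\<lambda>t. cis (of_int m * t)) has_integral ?F (2*pi) - ?F 0) {0..2*pi}"
  proof (rule fundamental_theorem_of_calculus)
    fix t :: real
    have "((\<lambda>t. exp (\<i> * of_int m * of_real t) / (\<i> * of_int m)) has_vector_derivative
            exp (\<i> * of_int m * of_real t)) (at t within {0..2*pi})"
      using False
      by (auto intro!: derivative_eq_intros has_vector_derivative_real_field)
    then show "(?F has_vector_derivative cis (of_int m * t)) (at t within {0..2*pi})"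
      by (simp add: cis_conv_exp mult.assoc)
  qed simp
  moreover have "cis (of_int m * (2*pi)) = 1"
    by (metis cis_multiple_2pi Ints_of_int mult.commute)
  ultimately show ?thesis using False by simp
qed

lemma has_integral_norm_trig_poly:
  "((\<lambda>t. (\<Sum>k<n. c k * cis t ^ k) * cnj (\<Sum>k<n. c k * cis t ^ k)) has_integral
     of_real (2*pi * (\<Sum>k<n. (cmod (c k))\<^sup>2))) {0..2*pi}"
proof -
  have eq: "(\<Sum>k<n. c k * cis t ^ k) * cnj (\<Sum>k<n. c k * cis t ^ k) =
      (\<Sum>j<n. \<Sum>k<n. c j * cnj (c k) * cis (of_int (int j - int k) * t))" for t
  proof -
    have "cis t ^ j * cnj (cis t ^ k) = cis (of_int (int j - int k) * t)" for j k
      using Complex.DeMoivre[of t j] Complex.DeMoivre[of t k]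
      by (simp only: cis_cnj cis_mult) (simp add: left_diff_distrib)
    then show ?thesis
      unfolding cnj_sum sum_product
      by (intro sum.cong refl) (simp add: mult_ac flip: complex_cnj_power)
  qed
  have "((\<lambda>t. \<Sum>j<n. \<Sum>k<n. c j * cnj (c k) * cis (of_int (int j - int k) * t)) has_integral
     (\<Sum>j<n. \<Sum>k<n. c j * cnj (c k) * (if int j - int k = 0 then of_real (2*pi) else 0))) {0..2*pi}"
    by (intro has_integral_sum finite_lessThan has_integral_mult_right has_integral_cis_of_int)
  moreover have "(\<Sum>j<n. \<Sum>k<n. c j * cnj (c k) * (if int j - int k = 0 then of_real (2*pi) else 0))
      = (\<Sum>j<n. \<Sum>k<n. if j = k then c j * cnj (c k) * of_real (2*pi) else 0)"
    by (intro sum.cong refl) auto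
  moreover have "\<dots> = of_real (2*pi * (\<Sum>k<n. (cmod (c k))\<^sup>2))"
    by (simp add: sum_distrib_left)
       (simp add: complex_norm_square mult_ac flip: of_real_power)
  ultimately show ?thesis unfolding eq by simp
qed

lemma circle_mean_sums:
  assumes holf: "f holomorphic_on unit_disc" and r: "0 < r" "r < 1"
  shows "(\<lambda>k. (cmod (taylor_coeff f k))\<^sup>2 * (r\<^sup>2) ^ k) sums circle_mean f r"
proof -
  let ?a = "taylor_coeff f"
  let ?S = "\<lambda>n t. \<Sum>k<n. (?a k * of_real r ^ k) * cis t ^ k"
  let ?g = "\<lambda>t. f (of_real r * cis t)"
  have sums: "(\<lambda>k. ?a k * w ^ k) sums f w" if "w \<in> unit_disc" for w
    using holomorphic_power_series[OF holf that] by (simp add: taylor_coeff_def)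
  obtain r' where r': "r < r'" "r' < 1" using r dense by blast
  have "summable (\<lambda>k. ?a k * of_real r' ^ k)"
    using sums[of "of_real r'"] r r' by (auto simp: sums_iff)
  then have "ereal r' \<le> conv_radius ?a"
    using conv_radius_geI[of ?a "of_real r'"] r r' by simp
  then have rad: "ereal r < conv_radius ?a"
    using r' by (meson ereal_less_eq(3) less_ereal.simps(1) order_less_le_trans)
  have "uniform_limit (cball 0 r) (\<lambda>n x. \<Sum>i<n. ?a i * (x - 0) ^ i) (\<lambda>x. suminf (\<lambda>i. ?a i * (x - 0) ^ i)) sequentially"
    by (rule powser_uniform_limit[OF rad])
  then have "uniform_limit {0..2*pi} (\<lambda>n t. \<Sum>i<n. ?a i * (of_real r * cis t - 0) ^ i)
      (\<lambda>t. suminf (\<lambda>i. ?a i * (of_real r * cis t - 0) ^ i)) sequentially"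
    by (rule uniform_limit_compose') (use r in \<open>auto simp: norm_mult\<close>)
  moreover have "suminf (\<lambda>i. ?a i * (of_real r * cis t - 0) ^ i) = ?g t" for t
    using sums[of "of_real r * cis t"] r by (simp add: sums_iff norm_mult)
  ultimately have U: "uniform_limit {0..2*pi} ?S ?g sequentially"
    by (simp add: power_mult_distrib mult.assoc)
  have contS: "continuous_on {0..2*pi} (?S n)" for n
    by (intro continuous_intros)
  have contg: "continuous_on {0..2*pi} ?g"
    by (rule uniform_limit_theorem[OF _ U]) (use contS in auto)
  have bg: "bounded (?g ` {0..2*pi})"
    by (intro compact_imp_bounded compact_continuous_image contg) simp
  then have bg': "bounded ((\<lambda>t. cnj (?g t)) ` {0..2*pi})"
    by (auto simp: bounded_iff)
  have U': "uniform_limit {0..2*pi} (\<lambda>n t. cnj (?S n t)) (\<lambda>t. cnj (?g t)) sequentially"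
    by (rule bounded_linear.uniform_limit[OF bounded_linear_cnj U])
  have U2: "uniform_limit {0..2*pi} (\<lambda>n t. ?S n t * cnj (?S n t)) (\<lambda>t. ?g t * cnj (?g t)) sequentially"
    by (rule bounded_bilinear.bounded_uniform_limit[OF bounded_bilinear_mult U U' bg' bg])
  have cont2: "continuous_on {0..2*pi} (\<lambda>t. ?S n t * cnj (?S n t))" for n
    by (intro continuous_intros)
  obtain I J where IJ: "\<And>n. ((\<lambda>t. ?S n t * cnj (?S n t)) has_integral I n) {0..2*pi}"
      "((\<lambda>t. ?g t * cnj (?g t)) has_integral J) {0..2*pi}" "I \<longlonglongrightarrow> J"
    using uniform_limit_integral[OF U2 cont2 sequentially_bot] by blast
  have I: "I n = of_real (2*pi * (\<Sum>k<n. (cmod (?a k * of_real r ^ k))\<^sup>2))" for n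
    using has_integral_unique[OF IJ(1) has_integral_norm_trig_poly] .
  have "((\<lambda>t. Re (?g t * cnj (?g t))) has_integral Re J) {0..2*pi}"
    using has_integral_linear[OF IJ(2) bounded_linear_Re] by (simp add: o_def)
  then have "((\<lambda>t. (cmod (?g t))\<^sup>2) has_integral Re J) {0..2*pi}"
    by (simp only: Re_complex_of_real flip: complex_norm_square)
  then have J: "circle_mean f r = Re J / (2*pi)"
    by (simp add: circle_mean_def integral_unique)
  have "(\<lambda>n. Re (I n) / (2*pi)) \<longlonglongrightarrow> Re J / (2*pi)"
    by (intro tendsto_intros IJ(3)) simp
  moreover have "Re (I n) / (2*pi) = (\<Sum>k<n. (cmod (?a k))\<^sup>2 * (r\<^sup>2) ^ k)" for n
    unfolding I Re_complex_of_real using r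
    by (simp add: norm_mult norm_power power_mult_distrib power_commutes flip: power_mult)
       (simp add: mult.commute)
  ultimately show ?thesis by (simp add: sums_def J)
qed

lemma hardy_norm_sums:
  assumes "f \<in> hardy2"
  shows "(\<lambda>k. (cmod (taylor_coeff f k))\<^sup>2) sums (hardy_norm f)\<^sup>2"
proof -
  let ?b = "\<lambda>k. (cmod (taylor_coeff f k))\<^sup>2"
  let ?M = "SUP r\<in>{0<..<1}. circle_mean f r"
  have holf: "f holomorphic_on unit_disc" and bdd: "bdd_above (circle_mean f ` {0<..<1})"
    using assms by (auto simp: hardy2_def)
  note cms = circle_mean_sums[OF holf]
  have part: "(\<Sum>k<n. ?b k) \<le> ?M" for n
  proof -
    have "((\<lambda>r::real. \<Sum>k<n. ?b k * (r\<^sup>2) ^ k) \<longlongrightarrow> (\<Sum>k<n. ?b k * (1\<^sup>2) ^ k)) (at_left 1)"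
      by (intro tendsto_intros)
    moreover have "eventually (\<lambda>r. (\<Sum>k<n. ?b k * (r\<^sup>2) ^ k) \<le> ?M) (at_left (1::real))"
      using eventually_at_left_real[OF zero_less_one]
    proof eventually_elim
      case (elim r)
      have "(\<Sum>k<n. ?b k * (r\<^sup>2) ^ k) \<le> circle_mean f r"
        using cms[of r] elim by (intro sum_le_suminf[of _ "{..<n}", THEN order_trans]) (auto simp: sums_iff)
      also have "\<dots> \<le> ?M" using elim bdd by (intro cSUP_upper) auto
      finally show ?case .
    qed
    ultimately have "(\<Sum>k<n. ?b k * (1\<^sup>2) ^ k) \<le> ?M"
      by (rule tendsto_upperbound) simp
    then show ?thesis by simp
  qed
  have summ: "summable ?b" by (rule summableI_nonneg_bounded[OF _ part]) simp
  have "?M \<le> suminf ?b"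
  proof (rule cSUP_least)
    fix r :: real assume r: "r \<in> {0<..<1}"
    have "suminf (\<lambda>k. ?b k * (r\<^sup>2) ^ k) \<le> suminf ?b"
      using r cms[of r] summ
      by (intro suminf_le) (auto simp: sums_iff intro!: mult_right_le_one_le power_le_one)
    then show "circle_mean f r \<le> suminf ?b" using cms[of r] r by (simp add: sums_iff)
  qed simp
  moreover have "suminf ?b \<le> ?M" by (rule suminf_le_const[OF summ part])
  ultimately have eq: "suminf ?b = ?M" by simp
  have "0 \<le> suminf ?b" by (rule suminf_nonneg[OF summ]) simp
  then have "(hardy_norm f)\<^sup>2 = suminf ?b" by (simp add: hardy_norm_def eq)
  then show ?thesis using summ by (simp add: sums_iff)
qed

lemma hardy_norm_eq_ip_norm:
  assumes "f \<in> hardy2"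
  shows "hardy_norm f = ip_norm hardy_inner f"
proof -
  have "(\<lambda>k. of_real ((cmod (taylor_coeff f k))\<^sup>2) :: complex) sums of_real ((hardy_norm f)\<^sup>2)"
    using hardy_norm_sums[OF assms] by (simp only: sums_of_real_iff)
  then have *: "hardy_inner f f = of_real ((hardy_norm f)\<^sup>2)"
    unfolding hardy_inner_def by (simp only: sums_iff complex_norm_square)
  have "0 \<le> (SUP r\<in>{0<..<1}. circle_mean f r)"
  proof (rule cSUP_upper2[of _ _ "1/2"])
    show "bdd_above (circle_mean f ` {0<..<1})" using assms by (simp add: hardy2_def)
    show "0 \<le> circle_mean f (1/2)"
      unfolding circle_mean_def
      by (cases "(\<lambda>t. (cmod (f (of_real (1/2) * cis t)))\<^sup>2) integrable_on {0..2*pi}")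
         (auto intro!: divide_nonneg_pos integral_nonneg simp: not_integrable_integral)
  qed simp
  then have "0 \<le> hardy_norm f" by (simp add: hardy_norm_def)
  then show ?thesis unfolding ip_norm_def * by simp
qed


section \<open>Automorphisms of the disc\<close>

definition disc_automorphism :: "(complex \<Rightarrow> complex) \<Rightarrow> bool" where
  "disc_automorphism \<phi> \<longleftrightarrow>
     \<phi> holomorphic_on unit_disc \<and> bij_betw \<phi> unit_disc unit_disc \<and>
     inv_into unit_disc \<phi> holomorphic_on unit_disc"

definition elliptic_automorphism :: "(complex \<Rightarrow> complex) \<Rightarrow> bool" where
  "elliptic_automorphism \<phi> \<longleftrightarrow>
     disc_automorphism \<phi> \<and> (\<exists>!z. z \<in> unit_disc \<and> \<phi> z = z)"

definition automorphism_order :: "(complex \<Rightarrow> complex) \<Rightarrow> enat" where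
  "automorphism_order \<phi> =
     (if \<exists>n>0. \<forall>z\<in>unit_disc. (\<phi> ^^ n) z = z
      then enat (LEAST n. n > 0 \<and> (\<forall>z\<in>unit_disc. (\<phi> ^^ n) z = z))
      else \<infinity>)"

end

theory Submission
  imports Defs
begin

text \<open>
  Let \<open>b(z) = (a - z)/(1 - cnj a z)\<close>.  Then \<open>\<phi> \<circ> b = b \<circ> (\<omega> \<cdot>)\<close> with \<open>\<omega>\<close> a primitive cube root of unity, so the
  eigenspaces of \<open>T = C\<^sub>\<phi>\<close> are \<open>E\<^sub>j = closure of span {b\<^sup>m | m \<equiv> j mod 3}\<close>, and those of \<open>T\<^sup>*\<close> are
  \<open>F\<^sub>j = {p | p \<bottom> b\<^sup>m for m \<not>\<equiv> j mod 3}\<close>.  If \<open>T = C T\<^sup>* C\<close>, then \<open>C\<close> exchanges \<open>E\<^sub>j\<close> and \<open>F\<^sub>j\<close>.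
  Multiplication by \<open>b\<close> is isometric and maps \<open>(E\<^sub>0, E\<^sub>1)\<close> onto \<open>(E\<^sub>1, E\<^sub>2)\<close>; hence the angles between
  vectors of \<open>F\<^sub>0\<close> and \<open>F\<^sub>1\<close> occur between vectors of \<open>F\<^sub>1\<close> and \<open>F\<^sub>2\<close>.  But the Gram matrix of the system
  dual to \<open>(b\<^sup>m)\<close> is tridiagonal and constant along its diagonals except in its corner, so that
  \<open>F\<^sub>1\<close> and \<open>F\<^sub>2\<close> have cosine \<open>|a|/(1 + |a|\<^sup>2)\<close> whereas the corner gives \<open>F\<^sub>0\<close> and \<open>F\<^sub>1\<close> the larger
  cosine \<open>|a|/sqrt (1 + |a|\<^sup>2)\<close>.
\<close>

section \<open>Taylor coefficients and the inner product\<close>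

lemma taylor_coeff_fps:
  assumes "f has_fps_expansion F"
  shows "taylor_coeff f = fps_nth F"
  using fps_nth_fps_expansion[OF assms] by (simp add: taylor_coeff_def fun_eq_iff)

lemma has_fps_expansion_taylor:
  assumes "f holomorphic_on unit_disc"
  shows "f has_fps_expansion Abs_fps (taylor_coeff f)"
proof -
  have "f has_fps_expansion fps_expansion f 0"
    by (rule has_fps_expansion_fps_expansion[OF _ _ assms]) auto
  moreover have "fps_expansion f 0 = Abs_fps (taylor_coeff f)"
    by (simp add: fps_expansion_def taylor_coeff_def[abs_def])
  ultimately show ?thesis by simp
qed

lemma taylor_coeff_cong:
  assumes "\<And>z. z \<in> unit_disc \<Longrightarrow> f z = g z"
  shows "taylor_coeff f = taylor_coeff g"
proof -
  have "eventually (\<lambda>z. f z = g z) (nhds 0)"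
    using assms by (intro eventually_nhds_in_open[of unit_disc, THEN eventually_mono]) auto
  then have "(deriv ^^ k) f 0 = (deriv ^^ k) g 0" for k
    by (intro higher_deriv_cong_ev) auto
  then show ?thesis by (simp add: taylor_coeff_def fun_eq_iff)
qed

lemma taylor_coeff_sums:
  assumes "f holomorphic_on unit_disc" "z \<in> unit_disc"
  shows "(\<lambda>n. taylor_coeff f n * z ^ n) sums f z"
  using holomorphic_power_series[OF assms] by (simp add: taylor_coeff_def)

lemma taylor_coeff_add:
  assumes "f holomorphic_on unit_disc" "g holomorphic_on unit_disc"
  shows "taylor_coeff (\<lambda>z. f z + g z) n = taylor_coeff f n + taylor_coeff g n"
  using taylor_coeff_fps[OF has_fps_expansion_add[OF assms[THEN has_fps_expansion_taylor]]] by simp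

lemma taylor_coeff_cmult:
  assumes "f holomorphic_on unit_disc"
  shows "taylor_coeff (\<lambda>z. c * f z) n = c * taylor_coeff f n"
  using taylor_coeff_fps[OF has_fps_expansion_cmult_left[OF has_fps_expansion_taylor[OF assms]]] by simp

text \<open>A function with denominator \<open>1 - cnj a * z\<close> is handled by clearing the
  denominator: this formula then gives a recursion for its coefficients. The case split keeps the
  truncated index \<open>n - 1\<close> away from \<open>n = 0\<close>.\<close>

lemma taylor_coeff_linear_mult:
  assumes "f holomorphic_on unit_disc"
  shows "taylor_coeff (\<lambda>z. (c + d * z) * f z) n =
    c * taylor_coeff f n + (if n = 0 then 0 else d * taylor_coeff f (n - 1))"
proof -
  have "(\<lambda>z. (c + d * z) * f z) has_fps_expansion
      (fps_const c + fps_const d * fps_X) * Abs_fps (taylor_coeff f)"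
    by (intro fps_expansion_intros has_fps_expansion_taylor assms)
  then show ?thesis
    by (simp add: taylor_coeff_fps algebra_simps)
qed

lemma taylor_coeff_shift:
  assumes "f holomorphic_on unit_disc"
  shows "taylor_coeff (\<lambda>z. z * f z) n = (if n = 0 then 0 else taylor_coeff f (n - 1))"
  using taylor_coeff_linear_mult[OF assms, of 0 1 n] by simp

lemma taylor_coeff_rotate:
  assumes "f holomorphic_on unit_disc" "cmod \<omega> = 1"
  shows "taylor_coeff (\<lambda>z. f (\<omega> * z)) n = \<omega> ^ n * taylor_coeff f n"
  using higher_deriv_compose_linear[OF assms(1), of unit_disc 0 \<omega> n] assms(2)
  by (simp add: taylor_coeff_def norm_mult)

section \<open>Membership in the Hardy space: square-summable coefficients and bounded
  multipliers\<close>

lemma hardy2D: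
  assumes "f \<in> hardy2"
  shows "f holomorphic_on unit_disc"
    "summable (\<lambda>n. (cmod (taylor_coeff f n))\<^sup>2)"
  using assms hardy_norm_sums[OF assms] by (auto simp: hardy2_def sums_iff)

lemma hardy2_outside: "f \<in> hardy2 \<Longrightarrow> z \<notin> unit_disc \<Longrightarrow> f z = 0"
  by (auto simp: hardy2_def)

text \<open>Each circle mean is the coefficient sum with weights \<open>(r\<^sup>2) ^ k\<close>,
  which are at most 1. Phrasing the hypothesis by partial sums suits coefficientwise limits, where
  only finitely many coefficients are controlled at a time.\<close>

lemma hardy2_bounded_coeffI:
  assumes "f holomorphic_on unit_disc" "\<And>z. z \<notin> unit_disc \<Longrightarrow> f z = 0"
    and bound: "\<And>n. (\<Sum>k<n. (cmod (taylor_coeff f k))\<^sup>2) \<le> B"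
  shows "f \<in> hardy2" "(\<Sum>n. (cmod (taylor_coeff f n))\<^sup>2) \<le> B"
proof -
  have summ: "summable (\<lambda>n. (cmod (taylor_coeff f n))\<^sup>2)"
    by (rule summableI_nonneg_bounded[OF _ bound]) simp
  then show "(\<Sum>n. (cmod (taylor_coeff f n))\<^sup>2) \<le> B"
    by (rule suminf_le_const[OF _ bound])
  have "circle_mean f r \<le> (\<Sum>n. (cmod (taylor_coeff f n))\<^sup>2)" if r: "r \<in> {0<..<1}" for r
  proof -
    have "(\<Sum>k. (cmod (taylor_coeff f k))\<^sup>2 * (r\<^sup>2) ^ k) \<le> (\<Sum>n. (cmod (taylor_coeff f n))\<^sup>2)"
      using r circle_mean_sums[OF assms(1), of r] summ
      by (intro suminf_le) (auto simp: sums_iff intro!: mult_right_le_one_le power_le_one)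
    then show ?thesis
      using r circle_mean_sums[OF assms(1), of r] by (auto simp: sums_iff)
  qed
  then have "bdd_above (circle_mean f ` {0<..<1})" by (rule bdd_aboveI2)
  then show "f \<in> hardy2"
    using assms(1,2) by (auto simp: hardy2_def)
qed

lemma hardy2_coeffI:
  assumes "f holomorphic_on unit_disc" "\<And>z. z \<notin> unit_disc \<Longrightarrow> f z = 0"
    and "summable (\<lambda>n. (cmod (taylor_coeff f n))\<^sup>2)"
  shows "f \<in> hardy2"
proof (rule hardy2_bounded_coeffI)
  fix n
  show "(\<Sum>k<n. (cmod (taylor_coeff f k))\<^sup>2) \<le> (\<Sum>k. (cmod (taylor_coeff f k))\<^sup>2)"
    using assms(3) by (rule sum_le_suminf) auto
qed (use assms in auto)

lemma hardy2_add:
  assumes "f \<in> hardy2" "g \<in> hardy2"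
  shows "(\<lambda>z. f z + g z) \<in> hardy2"
proof (rule hardy2_coeffI)
  let ?h = "\<lambda>z. f z + g z"
  show "summable (\<lambda>n. (cmod (taylor_coeff ?h n))\<^sup>2)"
  proof (rule summable_comparison_test'[where N = 0])
    show "summable (\<lambda>n. 2 * (cmod (taylor_coeff f n))\<^sup>2 + 2 * (cmod (taylor_coeff g n))\<^sup>2)"
      using assms by (intro summable_add summable_mult hardy2D)
    fix n
    have "(cmod (taylor_coeff ?h n))\<^sup>2 \<le> (cmod (taylor_coeff f n) + cmod (taylor_coeff g n))\<^sup>2"
      using assms by (simp add: taylor_coeff_add hardy2D power_mono norm_triangle_ineq)
    also have "\<dots> \<le> 2 * (cmod (taylor_coeff f n))\<^sup>2 + 2 * (cmod (taylor_coeff g n))\<^sup>2"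
      using sum_squares_bound[of "cmod (taylor_coeff f n)" "cmod (taylor_coeff g n)"]
      by (simp add: power2_sum)
    finally show "norm ((cmod (taylor_coeff ?h n))\<^sup>2)
        \<le> 2 * (cmod (taylor_coeff f n))\<^sup>2 + 2 * (cmod (taylor_coeff g n))\<^sup>2"
      by simp
  qed
  show "f z + g z = 0" if "z \<notin> unit_disc" for z
    using that assms by (simp add: hardy2_outside)
  show "?h holomorphic_on unit_disc"
    using assms by (intro holomorphic_intros hardy2D)
qed

text \<open>Circle means are used because the pointwise bound passes to them at once, with factor
  \<open>B\<^sup>2\<close>, whereas the coefficients of a product are unwieldy.\<close>

lemma hardy2_bounded_mult:
  assumes f: "f \<in> hardy2" and m: "m holomorphic_on unit_disc"
    and bound: "\<And>z. z \<in> unit_disc \<Longrightarrow> cmod (m z) \<le> B"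
  shows "(\<lambda>z. m z * f z) \<in> hardy2"
proof -
  have holf: "f holomorphic_on unit_disc" by (simp add: hardy2D f)
  have holh: "(\<lambda>z. m z * f z) holomorphic_on unit_disc"
    by (intro holomorphic_intros holf m)
  obtain K where K: "\<And>r. r \<in> {0<..<1} \<Longrightarrow> circle_mean f r \<le> K"
    using f unfolding hardy2_def bdd_above_def by blast
  have "circle_mean (\<lambda>z. m z * f z) r \<le> B\<^sup>2 * K" if r: "r \<in> {0<..<1}" for r
  proof -
    have int: "(\<lambda>t. (cmod (g (of_real r * cis t)))\<^sup>2) integrable_on {0..2*pi}"
      if "g holomorphic_on unit_disc" for g
      using r by (intro integrable_continuous_real continuous_intros
          continuous_on_compose2[OF holomorphic_on_imp_continuous_on[OF that]])
        (auto simp: norm_mult)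
    have "integral {0..2*pi} (\<lambda>t. (cmod (m (of_real r * cis t) * f (of_real r * cis t)))\<^sup>2)
        \<le> integral {0..2*pi} (\<lambda>t. B\<^sup>2 * (cmod (f (of_real r * cis t)))\<^sup>2)"
    proof (rule integral_le)
      show "(cmod (m (of_real r * cis t) * f (of_real r * cis t)))\<^sup>2
          \<le> B\<^sup>2 * (cmod (f (of_real r * cis t)))\<^sup>2" for t
        using bound[of "of_real r * cis t"] r
        by (auto simp: norm_mult power_mult_distrib intro!: mult_right_mono power_mono)
    qed (intro int[OF holh] integrable_on_mult_right int[OF holf])+
    then have "circle_mean (\<lambda>z. m z * f z) r \<le> B\<^sup>2 * circle_mean f r"
      by (simp add: circle_mean_def divide_right_mono)
    also have "\<dots> \<le> B\<^sup>2 * K" by (intro mult_left_mono K r) auto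
    finally show ?thesis .
  qed
  then have "bdd_above (circle_mean (\<lambda>z. m z * f z) ` {0<..<1})" by (rule bdd_aboveI2)
  then show ?thesis
    using holh f by (auto simp: hardy2_def)
qed

lemma hardy2_cmult:
  assumes "f \<in> hardy2"
  shows "(\<lambda>z. c * f z) \<in> hardy2"
  by (rule hardy2_bounded_mult[OF assms, where B = "cmod c"]) auto

lemma hardy2_shift:
  assumes "f \<in> hardy2"
  shows "(\<lambda>z. z * f z) \<in> hardy2"
  by (rule hardy2_bounded_mult[OF assms, where B = 1]) auto

section \<open>The inner product as a sesquilinear form; the shift is isometric\<close>

lemma hardy_inner_summable:
  assumes "f \<in> hardy2" "g \<in> hardy2"
  shows "summable (\<lambda>k. taylor_coeff f k * cnj (taylor_coeff g k))"
proof (rule summable_comparison_test'[where N = 0])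
  show "summable (\<lambda>n. (cmod (taylor_coeff f n))\<^sup>2 + (cmod (taylor_coeff g n))\<^sup>2)"
    using assms by (intro summable_add hardy2D)
  fix n
  let ?x = "cmod (taylor_coeff f n)" and ?y = "cmod (taylor_coeff g n)"
  have "0 \<le> ?x * ?y" by simp
  then have "?x * ?y \<le> ?x\<^sup>2 + ?y\<^sup>2" using sum_squares_bound[of ?x ?y] by linarith
  then show "norm (taylor_coeff f n * cnj (taylor_coeff g n)) \<le> ?x\<^sup>2 + ?y\<^sup>2"
    by (simp add: norm_mult)
qed

lemma hardy_inner_sums:
  assumes "f \<in> hardy2" "g \<in> hardy2"
  shows "(\<lambda>k. taylor_coeff f k * cnj (taylor_coeff g k)) sums hardy_inner f g"
  unfolding hardy_inner_def by (rule summable_sums[OF hardy_inner_summable[OF assms]])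

lemma hardy_inner_commute:
  assumes "f \<in> hardy2" "g \<in> hardy2"
  shows "hardy_inner g f = cnj (hardy_inner f g)"
proof -
  have "(\<lambda>k. cnj (taylor_coeff f k * cnj (taylor_coeff g k))) sums cnj (hardy_inner f g)"
    by (simp only: sums_cnj hardy_inner_sums[OF assms])
  then have "(\<lambda>k. taylor_coeff g k * cnj (taylor_coeff f k)) sums cnj (hardy_inner f g)"
    by (simp add: mult.commute)
  then show ?thesis
    using hardy_inner_sums[OF assms(2,1)] by (rule sums_unique2[symmetric])
qed

lemma hardy_inner_add_left:
  assumes "f \<in> hardy2" "g \<in> hardy2" "h \<in> hardy2"
  shows "hardy_inner (\<lambda>z. f z + g z) h = hardy_inner f h + hardy_inner g h"
  using sums_add[OF hardy_inner_sums[OF assms(1,3)] hardy_inner_sums[OF assms(2,3)]] assms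
  by (simp add: hardy_inner_def sums_iff taylor_coeff_add hardy2D distrib_right)

lemma hardy_inner_cmult_left:
  assumes "f \<in> hardy2" "h \<in> hardy2"
  shows "hardy_inner (\<lambda>z. c * f z) h = c * hardy_inner f h"
  using sums_mult[OF hardy_inner_sums[OF assms], of c] assms
  by (simp add: hardy_inner_def sums_iff taylor_coeff_cmult hardy2D mult.assoc)

lemma hardy_inner_add_right:
  assumes "f \<in> hardy2" "g \<in> hardy2" "h \<in> hardy2"
  shows "hardy_inner h (\<lambda>z. f z + g z) = hardy_inner h f + hardy_inner h g"
  using assms by (simp add: hardy_inner_commute[of _ h] hardy2_add hardy_inner_add_left)

lemma hardy_inner_cmult_right:
  assumes "f \<in> hardy2" "h \<in> hardy2"
  shows "hardy_inner h (\<lambda>z. c * f z) = cnj c * hardy_inner h f"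
  using assms by (simp add: hardy_inner_commute[of _ h] hardy2_cmult hardy_inner_cmult_left)

lemmas hardy_inner_algebra =
  hardy_inner_add_left hardy_inner_add_right hardy_inner_cmult_left hardy_inner_cmult_right
  hardy2_add hardy2_cmult hardy2_shift

lemma hardy_inner_self:
  assumes "f \<in> hardy2"
  shows "hardy_inner f f = of_real (\<Sum>n. (cmod (taylor_coeff f n))\<^sup>2)"
proof -
  have "(\<lambda>n. of_real ((cmod (taylor_coeff f n))\<^sup>2) :: complex) sums
      of_real (\<Sum>n. (cmod (taylor_coeff f n))\<^sup>2)"
    using hardy2D(2)[OF assms] by (simp only: sums_of_real_iff summable_sums)
  then show ?thesis
    unfolding hardy_inner_def by (simp only: sums_iff complex_norm_square)
qed

lemma hardy_inner_shift:
  assumes "f \<in> hardy2" "g \<in> hardy2"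
  shows "hardy_inner (\<lambda>z. z * f z) (\<lambda>z. z * g z) = hardy_inner f g"
proof -
  have "(\<lambda>n. taylor_coeff (\<lambda>z. z * f z) (Suc n) * cnj (taylor_coeff (\<lambda>z. z * g z) (Suc n)))
      sums hardy_inner f g"
    using hardy_inner_sums[OF assms] assms by (simp add: taylor_coeff_shift hardy2D)
  from sums_Suc_imp[OF _ this] show ?thesis
    using assms by (simp add: taylor_coeff_shift hardy2D hardy_inner_def sums_iff)
qed

lemma hardy2_eqI:
  assumes "f \<in> hardy2" "g \<in> hardy2" "\<And>h. h \<in> hardy2 \<Longrightarrow> hardy_inner h f = hardy_inner h g"
  shows "f = g"
proof
  fix z
  \<comment> \<open>The difference is tested against itself. It is written as a sum with a scalar
    multiple to fit the linearity rules.\<close>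
  let ?d = "\<lambda>z. f z + (-1) * g z"
  have d: "?d \<in> hardy2" using assms by (intro hardy2_add hardy2_cmult)
  have "hardy_inner ?d ?d = hardy_inner ?d f + cnj (-1) * hardy_inner ?d g"
    using assms d by (simp only: hardy_inner_add_right hardy_inner_cmult_right hardy2_cmult)
  also have "\<dots> = 0" using assms(3)[OF d] by simp
  finally have "(\<Sum>n. (cmod (taylor_coeff ?d n))\<^sup>2) = 0"
    unfolding hardy_inner_self[OF d] by (simp only: of_real_eq_0_iff)
  then have "taylor_coeff ?d n = 0" for n
    using suminf_eq_zero_iff[OF hardy2D(2)[OF d]] by simp
  then have "?d z = 0" if "z \<in> unit_disc"
    using taylor_coeff_sums[OF hardy2D(1)[OF d] that] by (simp add: sums_iff)
  then show "f z = g z"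
    using hardy2_outside[OF assms(1)] hardy2_outside[OF assms(2)] by (cases "z \<in> unit_disc") auto
qed

text \<open>Polarization. Only the real part is compared, so the rule serves both the linear
  isometry \<open>U\<close> and the conjugate-linear \<open>C\<close>.\<close>

lemma Re_hardy_inner_eqI:
  assumes "f \<in> hardy2" "g \<in> hardy2" "f' \<in> hardy2" "g' \<in> hardy2"
    and "hardy_inner f' f' = hardy_inner f f" "hardy_inner g' g' = hardy_inner g g"
    and "hardy_inner (\<lambda>z. f' z + g' z) (\<lambda>z. f' z + g' z) =
      hardy_inner (\<lambda>z. f z + g z) (\<lambda>z. f z + g z)"
  shows "Re (hardy_inner f' g') = Re (hardy_inner f g)"
proof -
  have *: "Re (hardy_inner (\<lambda>z. f z + g z) (\<lambda>z. f z + g z)) =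
      Re (hardy_inner f f) + Re (hardy_inner g g) + 2 * Re (hardy_inner f g)"
    if "f \<in> hardy2" "g \<in> hardy2" for f g
    using that hardy_inner_commute[OF that] by (simp add: hardy_inner_algebra)
  show ?thesis using *[OF assms(1,2)] *[OF assms(3,4)] assms(5-7) by simp
qed

text \<open>The indicator supplies the extension by 0 that \<open>hardy2\<close> demands; it does
  not affect the germ at 0.\<close>

lemma taylor_coeff_monomial:
  "taylor_coeff (\<lambda>z. z ^ n * indicator unit_disc z) k = (if k = n then 1 else 0)"
proof -
  have "taylor_coeff (\<lambda>z. z ^ n * indicator unit_disc z) = taylor_coeff (\<lambda>z. z ^ n)"
    by (rule taylor_coeff_cong) simp
  then show ?thesis
    using taylor_coeff_fps[OF has_fps_expansion_fps_X_power] by (simp add: fps_X_power_nth)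
qed

lemma monomial_hardy2: "(\<lambda>z. z ^ n * indicator unit_disc z) \<in> hardy2"
proof (rule hardy2_coeffI)
  show "(\<lambda>z. z ^ n * indicator unit_disc z) holomorphic_on unit_disc"
    by (rule holomorphic_transform[of "\<lambda>z. z ^ n"]) (auto intro: holomorphic_intros)
  show "summable (\<lambda>k. (cmod (taylor_coeff (\<lambda>z. z ^ n * indicator unit_disc z) k))\<^sup>2)"
    by (rule summable_finite[of "{n}"]) (auto simp: taylor_coeff_monomial)
qed auto

lemma hardy_inner_monomial:
  assumes "f \<in> hardy2"
  shows "hardy_inner f (\<lambda>z. z ^ n * indicator unit_disc z) = taylor_coeff f n"
proof -
  have "taylor_coeff f k * cnj (taylor_coeff (\<lambda>z. z ^ n * indicator unit_disc z) k) =
      (if k = n then taylor_coeff f n else 0)" for k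
    by (simp add: taylor_coeff_monomial)
  then show ?thesis
    using hardy_inner_sums[OF assms monomial_hardy2[of n]] sums_single[of n "\<lambda>_. taylor_coeff f n"]
    by (simp add: sums_iff)
qed

lemmas taylor_coeff_indicator = taylor_coeff_monomial[of 0, simplified]
  and indicator_hardy2 = monomial_hardy2[of 0, simplified]
  and hardy_inner_indicator = hardy_inner_monomial[of _ 0, simplified]

section \<open>The unitary involution of a disc point\<close>

definition blaschke :: "complex \<Rightarrow> complex \<Rightarrow> complex" where
  "blaschke a z = (a - z) / (1 - cnj a * z)"

text \<open>Composition with \<open>b\<close> alone is not isometric for
  \<open>a \<noteq> 0\<close>; the weight, the normalized Szego kernel at \<open>a\<close>, turns it
  into a unitary involution.\<close>

definition hardy_flip :: "complex \<Rightarrow> (complex \<Rightarrow> complex) \<Rightarrow> complex \<Rightarrow> complex" where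
  "hardy_flip a f = (\<lambda>z. of_real (sqrt (1 - (cmod a)\<^sup>2)) / (1 - cnj a * z) *
     composition_op (blaschke a) f z)"

locale disc_point =
  fixes a :: complex
  assumes norm_a: "cmod a < 1"
begin

abbreviation "b \<equiv> blaschke a"
abbreviation "U \<equiv> hardy_flip a"
abbreviation "s \<equiv> complex_of_real (sqrt (1 - (cmod a)\<^sup>2))"

section \<open>The involution \<open>b\<close> of the disc and its multiplication operator\<close>

lemma norm_a_sq: "(cmod a)\<^sup>2 < 1"
  using norm_a by (simp add: power_less_one_iff)

lemma s_sq: "s * s = 1 - a * cnj a"
  using norm_a_sq by (simp flip: of_real_mult complex_norm_square)

lemma s_nonzero: "s \<noteq> 0"
  using norm_a_sq by simp

lemma denom_bound:
  assumes "z \<in> unit_disc"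
  shows "1 - cmod a \<le> cmod (1 - cnj a * z)"
proof -
  have "cmod a * cmod z \<le> cmod a"
    using assms by (intro mult_right_le_one_le) auto
  then show ?thesis
    using norm_triangle_ineq2[of 1 "cnj a * z"] by (simp add: norm_mult)
qed

lemma denom_nonzero: "z \<in> unit_disc \<Longrightarrow> 1 - cnj a * z \<noteq> 0"
  using denom_bound[of z] norm_a by auto

lemma blaschke_holomorphic: "b holomorphic_on unit_disc"
  unfolding blaschke_def[abs_def] using denom_nonzero by (intro holomorphic_intros) auto

lemma blaschke_in_disc:
  assumes "z \<in> unit_disc"
  shows "b z \<in> unit_disc"
proof -
  have "b z = - Moebius_function 0 a z"
    by (simp add: blaschke_def Moebius_function_def minus_divide_left)
  then show ?thesis using Moebius_function_norm_lt_1[of a z 0] norm_a assms by simp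
qed

text \<open>By this identity the two weights in \<open>U (U f)\<close> cancel, and the weight of
  \<open>U\<close> becomes a linear expression in \<open>b\<close>.\<close>

lemma denom_blaschke:
  assumes "z \<in> unit_disc"
  shows "1 - cnj a * b z = s * s / (1 - cnj a * z)"
  unfolding s_sq using denom_nonzero[OF assms] by (simp add: blaschke_def field_simps)

lemma blaschke_blaschke:
  assumes "z \<in> unit_disc"
  shows "b (b z) = z"
proof -
  have "a - b z = z * (s * s) / (1 - cnj a * z)"
    unfolding s_sq using denom_nonzero[OF assms] by (simp add: blaschke_def field_simps)
  then have "b (b z) = (z * (s * s) / (1 - cnj a * z)) / (s * s / (1 - cnj a * z))"
    unfolding blaschke_def[of a "b z"] denom_blaschke[OF assms] by simp
  then show ?thesis using s_nonzero denom_nonzero[OF assms] by simp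
qed

lemma blaschke_a: "b a = 0"
  by (simp add: blaschke_def)

lemma hardy2_blaschke_mult:
  assumes "f \<in> hardy2"
  shows "(\<lambda>z. b z * f z) \<in> hardy2"
  using blaschke_in_disc
  by (intro hardy2_bounded_mult[OF assms blaschke_holomorphic, of 1]) (auto simp: less_imp_le)

lemma hardy2_denom:
  assumes "f \<in> hardy2"
  shows "(\<lambda>z. c / (1 - cnj a * z) * f z) \<in> hardy2"
proof (rule hardy2_bounded_mult[OF assms])
  show "(\<lambda>z. c / (1 - cnj a * z)) holomorphic_on unit_disc"
    using denom_nonzero by (intro holomorphic_intros) auto
  show "cmod (c / (1 - cnj a * z)) \<le> cmod c / (1 - cmod a)" if "z \<in> unit_disc" for z
    using denom_bound[OF that] norm_a by (simp add: norm_divide frac_le)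
qed

text \<open>With \<open>f = (1 - cnj a z) g\<close> the product \<open>b f\<close> is \<open>(a - z) g\<close>, and the two sides agree because
  the shift is isometric.\<close>

lemma hardy_inner_blaschke:
  assumes f: "f \<in> hardy2" and f': "f' \<in> hardy2"
  shows "hardy_inner (\<lambda>z. b z * f z) (\<lambda>z. b z * f' z) = hardy_inner f f'"
proof -
  define g where "g f = (\<lambda>z. 1 / (1 - cnj a * z) * f z)" for f :: "complex \<Rightarrow> complex"
  have g: "g f \<in> hardy2" if "f \<in> hardy2" for f
    unfolding g_def by (rule hardy2_denom[OF that])
  have eqs: "f = (\<lambda>z. g f z + (- cnj a) * (z * g f z))"
      "(\<lambda>z. b z * f z) = (\<lambda>z. a * g f z + (- 1) * (z * g f z))"
    if "f \<in> hardy2" for f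
  proof -
    have "f z = (1 - cnj a * z) * g f z" for z
      using denom_nonzero[of z] hardy2_outside[OF that, of z]
      by (cases "z \<in> unit_disc") (auto simp: g_def)
    then have "f z = g f z + (- cnj a) * (z * g f z)" for z
      by (simp add: left_diff_distrib mult.assoc)
    then show "f = (\<lambda>z. g f z + (- cnj a) * (z * g f z))" by blast
    show "(\<lambda>z. b z * f z) = (\<lambda>z. a * g f z + (- 1) * (z * g f z))"
      by (auto simp: g_def blaschke_def algebra_simps diff_divide_distrib)
  qed
  \<comment> \<open>The pairs \<open>(c, d) = (1, - cnj a)\<close> and \<open>(a, - 1)\<close> give
    the same three coefficients \<open>1 + a * cnj a\<close>, \<open>- a\<close> and
    \<open>- cnj a\<close>.\<close>
  have expand: "hardy_inner (\<lambda>z. c * h z + d * (z * h z)) (\<lambda>z. c * h' z + d * (z * h' z)) =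
      (c * cnj c + d * cnj d) * hardy_inner h h' + c * cnj d * hardy_inner h (\<lambda>z. z * h' z) +
      d * cnj c * hardy_inner (\<lambda>z. z * h z) h'"
    if "h \<in> hardy2" "h' \<in> hardy2" for c d h h'
    using that by (simp add: hardy_inner_algebra hardy_inner_shift) (simp add: algebra_simps)
  have "hardy_inner f f' = hardy_inner (\<lambda>z. 1 * g f z + (- cnj a) * (z * g f z))
      (\<lambda>z. 1 * g f' z + (- cnj a) * (z * g f' z))"
    using eqs(1)[OF f] eqs(1)[OF f'] by simp
  then show ?thesis
    unfolding eqs(2)[OF f] eqs(2)[OF f'] expand[OF g[OF f] g[OF f']] by (simp add: algebra_simps)
qed

section \<open>The operator \<open>U\<close> and its unitarity\<close>

lemma flip_add: "U (\<lambda>z. f z + g z) = (\<lambda>z. U f z + U g z)"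
  by (auto simp: hardy_flip_def composition_op_def fun_eq_iff distrib_left add_divide_distrib)

lemma flip_cmult: "U (\<lambda>z. c * f z) = (\<lambda>z. c * U f z)"
  by (auto simp: hardy_flip_def composition_op_def algebra_simps)

lemma flip_shift: "U (\<lambda>z. z * f z) = (\<lambda>z. b z * U f z)"
  by (auto simp: hardy_flip_def composition_op_def algebra_simps)

lemma flip_outside: "z \<notin> unit_disc \<Longrightarrow> U f z = 0"
  by (simp add: hardy_flip_def composition_op_def)

lemma flip_flip:
  assumes "f \<in> hardy2"
  shows "U (U f) = f"
proof
  fix z
  show "U (U f) z = f z"
  proof (cases "z \<in> unit_disc")
    case True
    then have "U (U f) z = s / (1 - cnj a * z) * (s / (1 - cnj a * b z) * f z)"
      using blaschke_in_disc by (simp add: hardy_flip_def composition_op_def blaschke_blaschke del: mem_ball)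
    then show ?thesis
      using True s_nonzero denom_nonzero by (simp add: denom_blaschke del: mem_ball)
  qed (use flip_outside hardy2_outside[OF assms] in auto)
qed

lemma comp_blaschke_holomorphic:
  assumes "f holomorphic_on unit_disc"
  shows "composition_op b f holomorphic_on unit_disc"
proof (rule holomorphic_transform)
  show "(f \<circ> b) holomorphic_on unit_disc"
    using blaschke_in_disc by (intro holomorphic_on_compose_gen[OF blaschke_holomorphic assms]) auto
qed (simp add: composition_op_def)

lemma flip_holomorphic:
  assumes "f holomorphic_on unit_disc"
  shows "U f holomorphic_on unit_disc"
  unfolding hardy_flip_def using denom_nonzero
  by (intro holomorphic_intros comp_blaschke_holomorphic assms) auto

lemma flip_one: "U (indicator unit_disc) = (\<lambda>z. s / (1 - cnj a * z) * indicator unit_disc z)"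
  using blaschke_in_disc by (auto simp: hardy_flip_def composition_op_def indicator_def)

lemma flip_one_hardy2: "U (indicator unit_disc) \<in> hardy2"
  unfolding flip_one by (rule hardy2_denom[OF indicator_hardy2])

lemma taylor_coeff_flip_one: "taylor_coeff (U (indicator unit_disc)) n = s * cnj a ^ n"
proof -
  let ?e = "U (indicator unit_disc)"
  have "(\<lambda>z. (1 + (- cnj a) * z) * ?e z) = (\<lambda>z. s * indicator unit_disc z)"
    using denom_nonzero by (auto simp: flip_one indicator_def fun_eq_iff)
  then have rec: "taylor_coeff ?e n - (if n = 0 then 0 else cnj a * taylor_coeff ?e (n - 1)) =
      (if n = 0 then s else 0)" for n
    using taylor_coeff_linear_mult[OF hardy2D(1)[OF flip_one_hardy2], of 1 "- cnj a" n]
    by (simp add: taylor_coeff_cmult[OF hardy2D(1)[OF indicator_hardy2]] taylor_coeff_indicator split: if_splits)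
  show ?thesis
  proof (induction n)
    case 0
    show ?case using rec[of 0] by simp
  next
    case (Suc n)
    then show ?case using rec[of "Suc n"] by simp
  qed
qed

text \<open>The coefficients \<open>s * cnj a ^ n\<close> make \<open>U 1\<close> equal to
  \<open>s\<close> times the reproducing kernel at \<open>a\<close>.\<close>

lemma hardy_inner_flip_one:
  assumes "f \<in> hardy2"
  shows "hardy_inner f (U (indicator unit_disc)) = s * f a"
proof -
  have "(\<lambda>n. s * (taylor_coeff f n * a ^ n)) sums (s * f a)"
    using norm_a by (intro sums_mult taylor_coeff_sums hardy2D(1) assms) simp
  then show ?thesis
    using hardy_inner_sums[OF assms flip_one_hardy2]
    by (simp add: taylor_coeff_flip_one sums_iff mult_ac)
qed

text \<open>Induction by Horner's scheme: for \<open>c + z * q\<close> the image is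
  \<open>c * e + b * U q\<close> with \<open>e = U 1\<close> of norm 1. The summands are orthogonal
  because pairing with \<open>e\<close> evaluates at \<open>a\<close>, where \<open>b\<close>
  vanishes, and multiplication by \<open>b\<close> preserves norms.\<close>

lemma flip_polynomial:
  "U (\<lambda>z. (\<Sum>n<N. c n * z ^ n) * indicator unit_disc z) \<in> hardy2 \<and>
   hardy_inner (U (\<lambda>z. (\<Sum>n<N. c n * z ^ n) * indicator unit_disc z))
     (U (\<lambda>z. (\<Sum>n<N. c n * z ^ n) * indicator unit_disc z)) = of_real (\<Sum>n<N. (cmod (c n))\<^sup>2)"
proof (induction N arbitrary: c)
  case 0
  have "U (\<lambda>z. 0) = (\<lambda>z. 0 * indicator unit_disc z)"
    by (auto simp: hardy_flip_def composition_op_def)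
  then show ?case
    using hardy2_cmult[OF indicator_hardy2, of 0]
      hardy_inner_cmult_left[OF indicator_hardy2 hardy2_cmult[OF indicator_hardy2, of 0], of 0]
    by simp
next
  case (Suc N)
  let ?e = "U (indicator unit_disc)"
  define g where "g = U (\<lambda>z. (\<Sum>n<N. c (Suc n) * z ^ n) * indicator unit_disc z)"
  have "(\<lambda>z. (\<Sum>n<Suc N. c n * z ^ n) * indicator unit_disc z) =
      (\<lambda>z. c 0 * indicator unit_disc z + z * ((\<Sum>n<N. c (Suc n) * z ^ n) * indicator unit_disc z))"
    by (simp add: sum.lessThan_Suc_shift sum_distrib_left algebra_simps del: sum.lessThan_Suc)
  then have eq: "U (\<lambda>z. (\<Sum>n<Suc N. c n * z ^ n) * indicator unit_disc z) =
      (\<lambda>z. c 0 * ?e z + b z * g z)"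
    by (simp only: flip_add flip_cmult flip_shift g_def)
  have g: "g \<in> hardy2" "hardy_inner g g = of_real (\<Sum>n<N. (cmod (c (Suc n)))\<^sup>2)"
    using Suc.IH[of "\<lambda>n. c (Suc n)"] by (auto simp: g_def)
  note bg = hardy2_blaschke_mult[OF g(1)] and e = flip_one_hardy2
  have "hardy_inner (\<lambda>z. b z * g z) ?e = 0"
    using hardy_inner_flip_one[OF bg] by (simp add: blaschke_a)
  moreover have "hardy_inner ?e (\<lambda>z. b z * g z) = 0"
    using calculation by (simp add: hardy_inner_commute[OF bg e])
  moreover have "hardy_inner ?e ?e = 1"
    using hardy_inner_flip_one[OF e] norm_a denom_nonzero[of a] s_sq by (simp add: flip_one mult.commute)
  ultimately have "hardy_inner (\<lambda>z. c 0 * ?e z + b z * g z) (\<lambda>z. c 0 * ?e z + b z * g z) =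
      c 0 * cnj (c 0) + hardy_inner g g"
    using bg e g by (simp add: hardy_inner_algebra hardy_inner_blaschke)
  also have "\<dots> = of_real (\<Sum>n<Suc N. (cmod (c n))\<^sup>2)"
    unfolding g(2) by (simp add: sum.lessThan_Suc_shift complex_norm_square del: sum.lessThan_Suc flip: of_real_power)
  finally show ?case unfolding eq using bg e by (simp add: hardy2_add hardy2_cmult)
qed

text \<open>The images of the Taylor polynomials converge uniformly near 0, hence coefficient by
  coefficient. Passing to the limit in finite sums of squares yields only an inequality, but also
  the membership of \<open>U f\<close> in the space.\<close>

lemma flip_contractive:
  assumes f: "f \<in> hardy2"
  shows "U f \<in> hardy2 \<and>
    (\<Sum>n. (cmod (taylor_coeff (U f) n))\<^sup>2) \<le> (\<Sum>n. (cmod (taylor_coeff f n))\<^sup>2)"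
proof -
  let ?B = "\<Sum>n. (cmod (taylor_coeff f n))\<^sup>2"
  \<comment> \<open>The radius is arbitrary below 1: convergence of Taylor coefficients at 0 needs
    only a neighbourhood of 0.\<close>
  let ?A = "ball 0 (1/2) :: complex set"
  define P where "P N = (\<lambda>z. (\<Sum>n<N. taylor_coeff f n * z ^ n) * indicator unit_disc z)" for N
  have UP: "U (P N) \<in> hardy2" "hardy_inner (U (P N)) (U (P N)) =
      of_real (\<Sum>n<N. (cmod (taylor_coeff f n))\<^sup>2)" for N
    using flip_polynomial[of "taylor_coeff f" N] by (auto simp: P_def)
  have partial: "(\<Sum>k<n. (cmod (taylor_coeff (U (P N)) k))\<^sup>2) \<le> ?B" for n N
  proof -
    have "(\<Sum>k<n. (cmod (taylor_coeff (U (P N)) k))\<^sup>2) \<le>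
        (\<Sum>k. (cmod (taylor_coeff (U (P N)) k))\<^sup>2)"
      by (rule sum_le_suminf[OF hardy2D(2)[OF UP(1)]]) auto
    also have "\<dots> = (\<Sum>n<N. (cmod (taylor_coeff f n))\<^sup>2)"
      using UP(2)[of N] unfolding hardy_inner_self[OF UP(1)] of_real_eq_iff .
    also have "\<dots> \<le> ?B"
      by (rule sum_le_suminf[OF hardy2D(2)[OF f]]) auto
    finally show ?thesis .
  qed
  have sub: "cball 0 (1/2) \<subseteq> unit_disc" by auto
  have contb: "continuous_on (cball 0 (1/2)) (\<lambda>z. cmod (b z))"
    using holomorphic_on_imp_continuous_on[OF blaschke_holomorphic] sub
    by (intro continuous_intros) (auto intro: continuous_on_subset)
  obtain w where w: "w \<in> cball 0 (1/2)" "\<And>z. z \<in> cball 0 (1/2) \<Longrightarrow> cmod (b z) \<le> cmod (b w)"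
    using continuous_attains_sup[OF compact_cball _ contb] by (metis ball_eq_empty ball_subset_cball
        centre_in_cball divide_nonneg_pos empty_iff zero_le_one zero_less_numeral)
  \<comment> \<open>\<open>b\<close> maps \<open>?A\<close> into a disc of radius
    \<open>r < 1\<close>, on which the power series of \<open>f\<close> converges uniformly; the
    larger \<open>r'\<close> witnesses that \<open>r\<close> lies below the radius of
    convergence.\<close>
  obtain r where r: "cmod (b w) < r" "r < 1"
    using blaschke_in_disc[of w] w(1) sub dense[of "cmod (b w)" 1] by (auto simp del: mem_cball)
  obtain r' where r': "r < r'" "r' < 1" using r dense by blast
  have pos: "0 < r" using r(1) norm_ge_zero[of "b w"] by linarith
  have "summable (\<lambda>k. taylor_coeff f k * of_real r' ^ k)"
    using taylor_coeff_sums[OF hardy2D(1)[OF f], of "of_real r'"] r' pos by (auto simp: sums_iff)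
  then have "ereal r' \<le> conv_radius (taylor_coeff f)"
    using conv_radius_geI[of "taylor_coeff f" "of_real r'"] r' pos by simp
  then have rad: "ereal r < conv_radius (taylor_coeff f)"
    using r' by (meson ereal_less_eq(3) less_ereal.simps(1) order_less_le_trans)
  have bA: "b \<in> ?A \<rightarrow> cball 0 r"
  proof
    show "b z \<in> cball 0 r" if "z \<in> ?A" for z
      using w(2)[of z] r(1) that by auto
  qed
  have "uniform_limit ?A (\<lambda>N z. \<Sum>i<N. taylor_coeff f i * (b z - 0) ^ i)
      (\<lambda>z. suminf (\<lambda>i. taylor_coeff f i * (b z - 0) ^ i)) sequentially"
    by (rule uniform_limit_compose'[OF powser_uniform_limit[OF rad] bA])
  moreover have "suminf (\<lambda>i. taylor_coeff f i * (b z - 0) ^ i) = f (b z)" if "z \<in> ?A" for z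
    using taylor_coeff_sums[OF hardy2D(1)[OF f], of "b z"] blaschke_in_disc[of z] that
    by (simp add: sums_iff)
  ultimately have ulf: "uniform_limit ?A (\<lambda>N z. \<Sum>i<N. taylor_coeff f i * b z ^ i) (\<lambda>z. f (b z)) sequentially"
    by (simp cong: uniform_limit_cong' del: mem_ball mem_ball_0)
  have bdd1: "bounded ((\<lambda>z. s / (1 - cnj a * z)) ` ?A)"
  proof (rule boundedI)
    show "norm x \<le> cmod s / (1 - cmod a)" if "x \<in> (\<lambda>z. s / (1 - cnj a * z)) ` ?A" for x
      using that denom_bound norm_a by (auto simp: norm_divide intro!: frac_le)
  qed
  have bdd2: "bounded ((\<lambda>z. f (b z)) ` ?A)"
  proof (rule bounded_subset)
    show "bounded (f ` cball 0 r)"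
      using r holomorphic_on_imp_continuous_on[OF hardy2D(1)[OF f]]
      by (intro compact_imp_bounded compact_continuous_image) (auto intro: continuous_on_subset)
    show "(\<lambda>z. f (b z)) ` ?A \<subseteq> f ` cball 0 r"
      using bA by blast
  qed
  have "uniform_limit ?A (\<lambda>N z. s / (1 - cnj a * z) * (\<Sum>i<N. taylor_coeff f i * b z ^ i))
      (\<lambda>z. s / (1 - cnj a * z) * f (b z)) sequentially"
    by (rule bounded_bilinear.bounded_uniform_limit[OF bounded_bilinear_mult uniform_limit_const ulf bdd2 bdd1])
  moreover have "U (P N) z = s / (1 - cnj a * z) * (\<Sum>i<N. taylor_coeff f i * b z ^ i)"
      "U f z = s / (1 - cnj a * z) * f (b z)" if "z \<in> ?A" for z N
    using that blaschke_in_disc[of z] by (auto simp: hardy_flip_def composition_op_def P_def)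
  ultimately have ul: "uniform_limit ?A (\<lambda>N. U (P N)) (U f) sequentially"
    by (simp cong: uniform_limit_cong' del: mem_ball mem_ball_0)
  have "(\<lambda>N. taylor_coeff (U (P N)) k) \<longlonglongrightarrow> taylor_coeff (U f) k" for k
  proof -
    have "U (P N) holomorphic_on ?A" for N
      by (rule holomorphic_on_subset[OF hardy2D(1)[OF UP(1)]]) auto
    then show ?thesis
      unfolding taylor_coeff_def
      by (intro tendsto_intros higher_deriv_complex_uniform_limit[OF ul]) auto
  qed
  then have lim: "(\<lambda>N. \<Sum>k<n. (cmod (taylor_coeff (U (P N)) k))\<^sup>2) \<longlonglongrightarrow>
      (\<Sum>k<n. (cmod (taylor_coeff (U f) k))\<^sup>2)" for n
    by (intro tendsto_intros)
  have bound: "(\<Sum>k<n. (cmod (taylor_coeff (U f) k))\<^sup>2) \<le> ?B" for n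
    using LIMSEQ_le_const2[OF lim] partial by blast
  show ?thesis
    using hardy2_bounded_coeffI[OF flip_holomorphic[OF hardy2D(1)[OF f]] flip_outside bound] by blast
qed

lemma flip_hardy2: "f \<in> hardy2 \<Longrightarrow> U f \<in> hardy2"
  using flip_contractive by blast

text \<open>A contraction that is its own inverse is isometric.\<close>

lemma hardy_inner_flip_self:
  assumes "f \<in> hardy2"
  shows "hardy_inner (U f) (U f) = hardy_inner f f"
proof -
  have "(\<Sum>n. (cmod (taylor_coeff (U f) n))\<^sup>2) = (\<Sum>n. (cmod (taylor_coeff f n))\<^sup>2)"
    using flip_contractive[OF assms] flip_contractive[OF flip_hardy2[OF assms]] flip_flip[OF assms]
    by auto
  then show ?thesis by (simp add: hardy_inner_self assms flip_hardy2)
qed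

text \<open>Polarization gives the real parts; replacing \<open>g\<close> by \<open>\<i> * g\<close>
  gives the imaginary parts.\<close>

lemma hardy_inner_flip:
  assumes "f \<in> hardy2" "g \<in> hardy2"
  shows "hardy_inner (U f) (U g) = hardy_inner f g"
proof -
  have *: "Re (hardy_inner (U f) (U g)) = Re (hardy_inner f g)" if "f \<in> hardy2" "g \<in> hardy2" for f g
    using that hardy_inner_flip_self[OF hardy2_add[OF that]]
    by (intro Re_hardy_inner_eqI) (auto simp: flip_hardy2 hardy_inner_flip_self flip_add)
  have "Im (hardy_inner (U f) (U g)) = Im (hardy_inner f g)"
    using *[OF assms(1) hardy2_cmult[OF assms(2), of \<i>]] assms
    by (simp add: flip_cmult hardy_inner_cmult_right flip_hardy2)
  then show ?thesis using *[OF assms] by (simp add: complex_eq_iff)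
qed

end

section \<open>Complex symmetry\<close>

text \<open>The definition only asks that norms be preserved. Polarization gives the real parts, and
  conjugate-linearity at \<open>\<i> * g\<close> reverses the sign of the imaginary part.\<close>

lemma hardy_inner_conjugation:
  assumes C: "conjugation_on hardy2 hardy_inner C" and fg: "f \<in> hardy2" "g \<in> hardy2"
  shows "hardy_inner (C f) (C g) = cnj (hardy_inner f g)"
proof -
  have mem: "C f \<in> hardy2" if "f \<in> hardy2" for f
    using C that by (simp add: conjugation_on_def)
  have self: "hardy_inner (C f) (C f) = hardy_inner f f" if "f \<in> hardy2" for f
  proof -
    have "ip_norm hardy_inner (C f) = ip_norm hardy_inner f"
      using C that by (simp add: conjugation_on_def)
    then show ?thesis
      using that by (simp add: ip_norm_def hardy_inner_self mem)
  qed
  have *: "Re (hardy_inner (C f) (C g)) = Re (hardy_inner f g)" if "f \<in> hardy2" "g \<in> hardy2" for f g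
  proof (intro Re_hardy_inner_eqI that mem self)
    have "C (\<lambda>z. f z + g z) = (\<lambda>z. C f z + C g z)"
      using C that unfolding conjugation_on_def by blast
    then show "hardy_inner (\<lambda>z. C f z + C g z) (\<lambda>z. C f z + C g z) =
        hardy_inner (\<lambda>z. f z + g z) (\<lambda>z. f z + g z)"
      using self[OF hardy2_add[OF that]] by simp
  qed
  have "C (\<lambda>z. \<i> * g z) = (\<lambda>z. cnj \<i> * C g z)"
    using C fg unfolding conjugation_on_def by blast
  then have "Re (hardy_inner (C f) (\<lambda>z. cnj \<i> * C g z)) = Re (hardy_inner f (\<lambda>z. \<i> * g z))"
    using *[OF fg(1) hardy2_cmult[OF fg(2), of \<i>]] by simp
  then have "Im (hardy_inner (C f) (C g)) = - Im (hardy_inner f g)"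
    unfolding hardy_inner_cmult_right[OF mem[OF fg(2)] mem[OF fg(1)]]
      hardy_inner_cmult_right[OF fg(2,1)] by simp
  then show ?thesis using *[OF fg] by (simp add: complex_eq_iff)
qed

context disc_point
begin

text \<open>Conjugating by \<open>b\<close> moves the fixed point to 0. The Schwarz lemma for the
  conjugated map and for its inverse forces equality of moduli, hence a rotation.\<close>

lemma automorphism_conj_rotation:
  assumes \<phi>: "disc_automorphism \<phi>" and fixed: "\<phi> a = a"
  obtains \<omega> where "cmod \<omega> = 1" "\<And>z. z \<in> unit_disc \<Longrightarrow> \<phi> (b z) = b (\<omega> * z)"
proof -
  let ?\<chi> = "inv_into unit_disc \<phi>"
  have hol: "\<phi> holomorphic_on unit_disc" "?\<chi> holomorphic_on unit_disc"
    and bij: "bij_betw \<phi> unit_disc unit_disc"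
    using \<phi> by (auto simp: disc_automorphism_def)
  have a: "a \<in> unit_disc" using norm_a by simp
  have maps: "\<phi> z \<in> unit_disc" "?\<chi> z \<in> unit_disc" "?\<chi> (\<phi> z) = z" if "z \<in> unit_disc" for z
    using bij bij_betw_inv_into[OF bij] that
    by (auto simp: bij_betw_def inv_into_f_f simp del: mem_ball mem_ball_0)
  have "?\<chi> a = a" using maps(3)[OF a] fixed by simp
  have b0: "b 0 = a" by (simp add: blaschke_def)
  have conj: "(\<lambda>z. b (h (b z))) holomorphic_on ball 0 1" "b (h (b 0)) = 0"
      "\<And>z. cmod z < 1 \<Longrightarrow> cmod (b (h (b z))) < 1"
    if "h holomorphic_on unit_disc" "h ` unit_disc \<subseteq> unit_disc" "h a = a" for h
  proof -
    have sub: "b ` unit_disc \<subseteq> unit_disc" using blaschke_in_disc by blast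
    have "(b \<circ> (h \<circ> b)) holomorphic_on unit_disc"
      by (intro holomorphic_on_compose_gen[of _ _ _ unit_disc] blaschke_holomorphic that sub)
        (use that(2) sub in \<open>auto simp: image_subset_iff simp del: mem_ball mem_ball_0\<close>)
    then show "(\<lambda>z. b (h (b z))) holomorphic_on ball 0 1" by (simp add: o_def)
    show "b (h (b 0)) = 0" by (simp add: b0 that blaschke_a)
    show "cmod (b (h (b z))) < 1" if "cmod z < 1" for z
      using that blaschke_in_disc \<open>h ` unit_disc \<subseteq> unit_disc\<close> by (simp add: image_subset_iff)
  qed
  define \<psi> where "\<psi> = (\<lambda>z. b (\<phi> (b z)))"
  have \<psi>: "\<psi> holomorphic_on ball 0 1" "\<psi> 0 = 0" "\<And>z. cmod z < 1 \<Longrightarrow> cmod (\<psi> z) < 1"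
    using conj[of \<phi>] hol maps fixed by (auto simp: \<psi>_def simp del: mem_ball mem_ball_0)
  have \<chi>: "(\<lambda>z. b (?\<chi> (b z))) holomorphic_on ball 0 1" "b (?\<chi> (b 0)) = 0"
      "\<And>z. cmod z < 1 \<Longrightarrow> cmod (b (?\<chi> (b z))) < 1"
    using conj[of ?\<chi>] hol maps \<open>?\<chi> a = a\<close> by (auto simp del: mem_ball mem_ball_0)
  \<comment> \<open>Any nonzero point of the disc would do: equality in the Schwarz lemma at one
    such point suffices.\<close>
  have half: "cmod (1 / 2) < 1" by simp
  have inv: "b (?\<chi> (b (\<psi> (1/2)))) = 1/2"
    using maps blaschke_blaschke blaschke_in_disc half
    by (simp add: \<psi>_def del: mem_ball)
  have "cmod (1/2) \<le> cmod (\<psi> (1/2))"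
    using Schwarz_Lemma(1)[OF \<chi> \<psi>(3)[OF half]] unfolding inv .
  then have "cmod (\<psi> (1/2)) = cmod (1/2)"
    using Schwarz_Lemma(1)[OF \<psi> half] by simp
  then obtain \<omega> where \<omega>: "\<And>z. cmod z < 1 \<Longrightarrow> \<psi> z = \<omega> * z" "cmod \<omega> = 1"
    using Schwarz_Lemma(3)[OF \<psi> half] half by (metis divide_eq_0_iff zero_neq_numeral zero_neq_one)
  have "\<phi> (b z) = b (\<omega> * z)" if "z \<in> unit_disc" for z
    using \<omega>(1)[of z] that maps(1) blaschke_in_disc blaschke_blaschke[of "\<phi> (b z)"]
    by (auto simp: \<psi>_def)
  then show ?thesis using that \<omega>(2) by blast
qed

section \<open>Powers of \<open>b\<close>, the dual functionals and their coordinates under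
  \<open>U\<close>\<close>

lemma hardy_inner_flip_right:
  assumes "f \<in> hardy2" "g \<in> hardy2"
  shows "hardy_inner f (U g) = hardy_inner (U f) g"
  using hardy_inner_flip[OF flip_hardy2[OF assms(1)] assms(2)] by (simp add: flip_flip assms)

text \<open>The coefficients of \<open>f \<circ> b\<close> are the coefficients of \<open>f\<close>
  in powers of \<open>b\<close>, so these functionals are dual to the powers of \<open>b\<close>.
  The right-hand side expresses them through \<open>U f\<close>, which makes them bounded.\<close>

lemma taylor_coeff_comp_blaschke:
  assumes "f \<in> hardy2"
  shows "s * taylor_coeff (composition_op b f) n =
    taylor_coeff (U f) n - (if n = 0 then 0 else cnj a * taylor_coeff (U f) (n - 1))"
proof -
  have eq: "(\<lambda>z. (1 + (- cnj a) * z) * U f z) = (\<lambda>z. s * composition_op b f z)"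
    using denom_nonzero by (auto simp: hardy_flip_def composition_op_def fun_eq_iff)
  show ?thesis
    using taylor_coeff_linear_mult[OF hardy2D(1)[OF flip_hardy2[OF assms]], of 1 "- cnj a" n]
    unfolding eq taylor_coeff_cmult[OF comp_blaschke_holomorphic[OF hardy2D(1)[OF assms]]]
    by (simp split: if_splits)
qed

text \<open>In powers of \<open>b\<close> the operator is diagonal, so the dual functionals are
  eigenvectors of its adjoint.\<close>

lemma taylor_coeff_comp_blaschke_rotation:
  assumes "f \<in> hardy2" "cmod \<omega> = 1" "\<And>z. z \<in> unit_disc \<Longrightarrow> \<phi> (b z) = b (\<omega> * z)"
  shows "taylor_coeff (composition_op b (composition_op \<phi> f)) n =
    \<omega> ^ n * taylor_coeff (composition_op b f) n"
proof -
  have "taylor_coeff (composition_op b (composition_op \<phi> f)) =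
      taylor_coeff (\<lambda>z. composition_op b f (\<omega> * z))"
    using assms(2,3) blaschke_in_disc by (intro taylor_coeff_cong) (simp add: composition_op_def norm_mult)
  then show ?thesis
    using taylor_coeff_rotate[OF comp_blaschke_holomorphic[OF hardy2D(1)[OF assms(1)]] assms(2)] by simp
qed

lemma blaschke_power_hardy2: "(\<lambda>z. b z ^ n * indicator unit_disc z) \<in> hardy2"
proof (rule hardy2_bounded_mult[OF indicator_hardy2])
  show "(\<lambda>z. b z ^ n) holomorphic_on unit_disc"
    by (intro holomorphic_intros blaschke_holomorphic)
  show "cmod (b z ^ n) \<le> 1" if "z \<in> unit_disc" for z
    using blaschke_in_disc[OF that] by (simp add: norm_power power_le_one)
qed

text \<open>On the disc \<open>s * s / (1 - cnj a * z)\<close> equals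
  \<open>1 - cnj a * b z\<close>.\<close>

lemma flip_monomial:
  "(\<lambda>z. s * U (\<lambda>z. z ^ n * indicator unit_disc z) z) =
   (\<lambda>z. b z ^ n * indicator unit_disc z + (- cnj a) * (b z ^ Suc n * indicator unit_disc z))"
proof
  fix z
  show "s * U (\<lambda>z. z ^ n * indicator unit_disc z) z =
    b z ^ n * indicator unit_disc z + (- cnj a) * (b z ^ Suc n * indicator unit_disc z)"
  proof (cases "z \<in> unit_disc")
    case True
    then have "s * U (\<lambda>z. z ^ n * indicator unit_disc z) z = s * s / (1 - cnj a * z) * b z ^ n"
      using blaschke_in_disc by (simp add: hardy_flip_def composition_op_def)
    also have "\<dots> = (1 - cnj a * b z) * b z ^ n"
      using denom_blaschke[OF True] by simp
    finally show ?thesis using True by (simp add: algebra_simps)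
  qed (simp add: flip_outside)
qed

text \<open>\<open>U\<close> is self-adjoint, so this pairs \<open>p\<close> with
  \<open>flip_monomial\<close>. Orthogonality to powers of \<open>b\<close> thereby becomes a set of
  linear relations between neighbouring coefficients of \<open>U p\<close>.\<close>

lemma taylor_coeff_flip:
  assumes "p \<in> hardy2"
  shows "s * cnj (taylor_coeff (U p) n) =
    hardy_inner (\<lambda>z. b z ^ n * indicator unit_disc z) p -
    cnj a * hardy_inner (\<lambda>z. b z ^ Suc n * indicator unit_disc z) p"
proof -
  let ?e = "\<lambda>z. z ^ n * indicator unit_disc z"
  have "cnj (taylor_coeff (U p) n) = hardy_inner (U ?e) p"
    unfolding hardy_inner_commute[OF assms flip_hardy2[OF monomial_hardy2]]
      hardy_inner_flip_right[OF assms monomial_hardy2] hardy_inner_monomial[OF flip_hardy2[OF assms]] ..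
  then have "s * cnj (taylor_coeff (U p) n) = hardy_inner (\<lambda>z. s * U ?e z) p"
    using hardy_inner_cmult_left[OF flip_hardy2[OF monomial_hardy2] assms, of s n] by simp
  also have "\<dots> = hardy_inner (\<lambda>z. b z ^ n * indicator unit_disc z) p +
      (- cnj a) * hardy_inner (\<lambda>z. b z ^ Suc n * indicator unit_disc z) p"
    unfolding flip_monomial
    using hardy_inner_add_left[OF blaschke_power_hardy2 hardy2_cmult[OF blaschke_power_hardy2] assms]
      hardy_inner_cmult_left[OF blaschke_power_hardy2 assms] by metis
  finally show ?thesis by simp
qed

text \<open>The vectors \<open>p\<close> and \<open>q\<close> lie in \<open>F\<^sub>1\<close> and \<open>F\<^sub>2\<close>.\<close>

lemma eigenvector_angle:
  assumes p: "p \<in> hardy2" and q: "q \<in> hardy2"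
    and p0: "\<And>m. m mod 3 \<noteq> 1 \<Longrightarrow> hardy_inner (\<lambda>z. b z ^ m * indicator unit_disc z) p = 0"
    and q0: "\<And>m. m mod 3 \<noteq> 2 \<Longrightarrow> hardy_inner (\<lambda>z. b z ^ m * indicator unit_disc z) q = 0"
    and pp: "hardy_inner p p = 1" and qq: "hardy_inner q q = 1 + a * cnj a"
    and pq: "hardy_inner p q = - cnj a"
  shows "a = 0"
proof (rule ccontr)
  assume "a \<noteq> 0"
  define P Q where "P = taylor_coeff (U p)" and "Q = taylor_coeff (U q)"
  have mod: "Suc (n * 3) mod 3 = 1" "Suc (Suc (n * 3)) mod 3 = 2" "Suc (Suc (Suc (n * 3))) mod 3 = 0"
    for n :: nat by presburger+
  \<comment> \<open>In each block of three coefficients one entry is free: index 1 for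
    \<open>P\<close> and index 2 for \<open>Q\<close>. The preceding entry is \<open>- a\<close>
    times it and the third is 0. The squared norms are therefore \<open>1 + ?x\<close> times the
    sums over the free entries, and the inner product is \<open>- cnj a\<close> times
    theirs.\<close>
  have P: "cnj (P (n * 3)) = - cnj a * cnj (P (n * 3 + 1))" "P (n * 3 + 2) = 0" for n
  proof -
    have "s * cnj (P (n * 3)) = s * (- cnj a * cnj (P (n * 3 + 1)))"
      using taylor_coeff_flip[OF p, of "n * 3"] taylor_coeff_flip[OF p, of "n * 3 + 1"]
        p0[of "n * 3"] p0[of "Suc (n * 3 + 1)"] mod by (simp add: P_def)
    then show "cnj (P (n * 3)) = - cnj a * cnj (P (n * 3 + 1))"
      unfolding mult_left_cancel[OF s_nonzero] .
    have "s * cnj (P (n * 3 + 2)) = 0"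
      unfolding P_def taylor_coeff_flip[OF p] using p0[of "n * 3 + 2"] p0[of "Suc (n * 3 + 2)"] mod by simp
    then show "P (n * 3 + 2) = 0" using s_nonzero by simp
  qed
  have Q: "Q (n * 3) = 0" "cnj (Q (n * 3 + 1)) = - cnj a * cnj (Q (n * 3 + 2))" for n
  proof -
    have "s * cnj (Q (n * 3 + 1)) = s * (- cnj a * cnj (Q (n * 3 + 2)))"
      using taylor_coeff_flip[OF q, of "n * 3 + 1"] taylor_coeff_flip[OF q, of "n * 3 + 2"]
        q0[of "n * 3 + 1"] q0[of "Suc (n * 3 + 2)"] mod by (simp add: Q_def)
    then show "cnj (Q (n * 3 + 1)) = - cnj a * cnj (Q (n * 3 + 2))"
      unfolding mult_left_cancel[OF s_nonzero] .
    have "s * cnj (Q (n * 3)) = 0"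
      unfolding Q_def taylor_coeff_flip[OF q] using q0[of "n * 3"] q0[of "Suc (n * 3)"] mod by simp
    then show "Q (n * 3) = 0" using s_nonzero by simp
  qed
  have block: "{n * 3..<n * 3 + 3} = {n * 3, n * 3 + 1, n * 3 + 2}" for n :: nat
    by auto
  have group: "(\<lambda>n. F (n * 3) + F (n * 3 + 1) + F (n * 3 + 2)) sums S" if "F sums S"
    for F :: "nat \<Rightarrow> complex" and S
    using sums_group[OF that, of 3] unfolding block by (simp add: add.assoc)
  have cnj: "cnj x = - cnj a * cnj y \<Longrightarrow> x = - a * y" for x y
    by (metis complex_cnj_cnj complex_cnj_minus complex_cnj_mult)
  let ?x = "(cmod a)\<^sup>2"
  have x: "a * cnj a = of_real ?x" by (rule complex_norm_square[symmetric])
  have "(\<lambda>n. P n * cnj (P n)) sums 1" "(\<lambda>n. Q n * cnj (Q n)) sums (1 + a * cnj a)"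
      "(\<lambda>n. P n * cnj (Q n)) sums (- cnj a)"
    using hardy_inner_sums[OF flip_hardy2 flip_hardy2] p q pp qq pq hardy_inner_flip
    unfolding P_def Q_def by metis+
  note S = this[THEN group]
  have "P (n * 3) * cnj (P (n * 3)) + P (n * 3 + 1) * cnj (P (n * 3 + 1)) +
      P (n * 3 + 2) * cnj (P (n * 3 + 2)) = of_real ((1 + ?x) * (cmod (P (n * 3 + 1)))\<^sup>2)" for n
    using P[of n] cnj[OF P(1)[of n]] by (simp add: complex_norm_square algebra_simps del: of_real_power)
  with S(1) have "(\<lambda>n. of_real ((1 + ?x) * (cmod (P (n * 3 + 1)))\<^sup>2) :: complex) sums of_real 1"
    by simp
  then have "(\<lambda>n. (1 + ?x) * (cmod (P (n * 3 + 1)))\<^sup>2) sums 1"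
    by (simp only: sums_of_real_iff)
  from sums_divide[OF this, of "1 + ?x"]
  have sP: "(\<lambda>n. (cmod (P (n * 3 + 1)))\<^sup>2) sums (1 / (1 + ?x))"
    by (simp add: add_pos_nonneg less_imp_neq[symmetric])
  have "Q (n * 3) * cnj (Q (n * 3)) + Q (n * 3 + 1) * cnj (Q (n * 3 + 1)) +
      Q (n * 3 + 2) * cnj (Q (n * 3 + 2)) = of_real ((1 + ?x) * (cmod (Q (n * 3 + 2)))\<^sup>2)" for n
    using Q[of n] cnj[OF Q(2)[of n]] by (simp add: complex_norm_square algebra_simps del: of_real_power)
  with S(2) have "(\<lambda>n. of_real ((1 + ?x) * (cmod (Q (n * 3 + 2)))\<^sup>2) :: complex) sums of_real (1 + ?x)"
    unfolding x by simp
  then have "(\<lambda>n. (1 + ?x) * (cmod (Q (n * 3 + 2)))\<^sup>2) sums (1 + ?x)"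
    by (simp only: sums_of_real_iff)
  from sums_divide[OF this, of "1 + ?x"]
  have sQ: "(\<lambda>n. (cmod (Q (n * 3 + 2)))\<^sup>2) sums 1"
    by (simp add: add_pos_nonneg less_imp_neq[symmetric])
  have "P (n * 3) * cnj (Q (n * 3)) + P (n * 3 + 1) * cnj (Q (n * 3 + 1)) +
      P (n * 3 + 2) * cnj (Q (n * 3 + 2)) = - cnj a * (P (n * 3 + 1) * cnj (Q (n * 3 + 2)))" for n
    using P(2)[of n] Q[of n] by simp
  with S(3) have "(\<lambda>n. - cnj a * (P (n * 3 + 1) * cnj (Q (n * 3 + 2)))) sums (- cnj a)"
    by simp
  from sums_divide[OF this, of "- cnj a"] \<open>a \<noteq> 0\<close>
  have "(\<lambda>n. P (n * 3 + 1) * cnj (Q (n * 3 + 2))) sums 1" by simp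
  from sums_Re[OF this] have sPQ: "(\<lambda>n. Re (P (n * 3 + 1) * cnj (Q (n * 3 + 2)))) sums 1"
    by simp
  \<comment> \<open>The arithmetic-geometric mean replaces Cauchy-Schwarz: the squared norms of the
    free entries are \<open>1 / (1 + ?x)\<close> and 1, so their mean is already below the required
    inner product 1.\<close>
  have "Re (P (n * 3 + 1) * cnj (Q (n * 3 + 2)))
      \<le> ((cmod (P (n * 3 + 1)))\<^sup>2 + (cmod (Q (n * 3 + 2)))\<^sup>2) / 2" for n
  proof -
    have "Re (P (n * 3 + 1) * cnj (Q (n * 3 + 2))) \<le> cmod (P (n * 3 + 1)) * cmod (Q (n * 3 + 2))"
      using complex_Re_le_cmod[of "P (n * 3 + 1) * cnj (Q (n * 3 + 2))"] by (simp add: norm_mult)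
    also have "\<dots> \<le> ((cmod (P (n * 3 + 1)))\<^sup>2 + (cmod (Q (n * 3 + 2)))\<^sup>2) / 2"
      using sum_squares_bound[of "cmod (P (n * 3 + 1))" "cmod (Q (n * 3 + 2))"] by simp
    finally show ?thesis .
  qed
  then have "1 \<le> (1 / (1 + ?x) + 1) / 2"
    using sPQ sums_divide[OF sums_add[OF sP sQ]] by (rule sums_le)
  moreover have "1 / (1 + ?x) < 1" using \<open>a \<noteq> 0\<close> by (simp add: divide_less_eq add_pos_nonneg)
  ultimately show False by simp
qed

lemma not_complex_symmetric:
  assumes a: "a \<noteq> 0" and \<omega>: "cmod \<omega> = 1" "\<omega> ^ 3 = 1" "\<omega> \<noteq> 1"
    and \<phi>: "\<And>z. z \<in> unit_disc \<Longrightarrow> \<phi> (b z) = b (\<omega> * z)"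
  shows "\<not> complex_symmetric_on hardy2 hardy_inner (composition_op \<phi>)"
proof
  let ?T = "composition_op \<phi>" and ?I = "indicator unit_disc :: complex \<Rightarrow> complex"
  assume "complex_symmetric_on hardy2 hardy_inner ?T"
  then obtain C S where C: "conjugation_on hardy2 hardy_inner C"
    and S: "\<And>g. g \<in> hardy2 \<Longrightarrow> S g \<in> hardy2"
      "\<And>f g. f \<in> hardy2 \<Longrightarrow> g \<in> hardy2 \<Longrightarrow> hardy_inner (?T f) g = hardy_inner f (S g)"
    and T: "\<And>f. f \<in> hardy2 \<Longrightarrow> ?T f = C (S (C f))"
    unfolding complex_symmetric_on_def adjoint_on_def by blast
  have Cmem: "C f \<in> hardy2" and CC: "C (C f) = f" and Cmult: "C (\<lambda>z. c * f z) = (\<lambda>z. cnj c * C f z)"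
    if "f \<in> hardy2" for f c
    using C that unfolding conjugation_on_def by blast+
  note inner_C = hardy_inner_conjugation[OF C]
  have Tmem: "?T f \<in> hardy2" if "f \<in> hardy2" for f
    using T that by (simp add: Cmem S)
  have b\<phi>: "b (\<phi> z) = \<omega> * b z" "\<phi> z \<in> unit_disc" if "z \<in> unit_disc" for z
  proof -
    have "\<omega> * b z \<in> unit_disc" using blaschke_in_disc[OF that] \<omega>(1) by (simp add: norm_mult)
    moreover have "\<phi> z = b (\<omega> * b z)"
      using \<phi>[OF blaschke_in_disc[OF that]] blaschke_blaschke[OF that] by simp
    ultimately show "b (\<phi> z) = \<omega> * b z" "\<phi> z \<in> unit_disc"
      using blaschke_blaschke blaschke_in_disc by simp_all
  qed
  have \<omega>_mod: "\<omega> ^ m = \<omega> ^ (m mod 3)" for m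
  proof -
    have "\<omega> ^ m = \<omega> ^ (3 * (m div 3) + m mod 3)" by simp
    then show ?thesis unfolding power_add power_mult \<omega>(2) by simp
  qed
  \<comment> \<open>The three powers of \<open>\<omega>\<close> are distinct, so
    \<open>\<omega> ^ m\<close> determines \<open>m mod 3\<close>.\<close>
  have "\<omega> ^ 2 \<noteq> 1" using \<omega>(2,3) by (auto simp: power3_eq_cube power2_eq_square)
  moreover have "\<omega> ^ 2 \<noteq> \<omega>" using \<omega> by (auto simp: power2_eq_square)
  ultimately have \<omega>_eq: "m mod 3 = k" if "\<omega> ^ m = \<omega> ^ k" "k < 3" for m k :: nat
  proof -
    have "m mod 3 \<in> {0, 1, 2}" "k \<in> {0, 1, 2}" using that(2) by auto
    then show ?thesis
      using that(1) \<omega>(3) \<open>\<omega> ^ 2 \<noteq> 1\<close> \<open>\<omega> ^ 2 \<noteq> \<omega>\<close> unfolding \<omega>_mod[of m] by auto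
  qed

  let ?B = "\<lambda>m z. b z ^ m * ?I z"
  have TB: "?T (?B m) = (\<lambda>z. \<omega> ^ m * ?B m z)" for m
    using b\<phi> by (auto simp: composition_op_def fun_eq_iff power_mult_distrib)
  \<comment> \<open>\<open>C f\<close> is an eigenvector of the adjoint \<open>S\<close> for
    \<open>cnj (\<omega> ^ k)\<close>, and \<open>?B m\<close> one of \<open>?T\<close> for a
    different power of \<open>\<omega>\<close>.\<close>
  have orth: "hardy_inner (?B m) (C f) = 0"
    if f: "f \<in> hardy2" "?T f = (\<lambda>z. \<omega> ^ k * f z)" and "k < 3" "m mod 3 \<noteq> k" for f k m
  proof -
    have "S (C f) = C (?T f)" using T CC S(1) Cmem f(1) by simp
    also have "\<dots> = (\<lambda>z. cnj (\<omega> ^ k) * C f z)" unfolding f(2) by (rule Cmult[OF f(1)])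
    finally have "hardy_inner (?T (?B m)) (C f) = \<omega> ^ k * hardy_inner (?B m) (C f)"
      using S(2)[OF blaschke_power_hardy2 Cmem[OF f(1)], of m]
        hardy_inner_cmult_right[OF Cmem[OF f(1)] blaschke_power_hardy2[of m], where c = "cnj (\<omega> ^ k)"] by simp
    moreover have "hardy_inner (?T (?B m)) (C f) = \<omega> ^ m * hardy_inner (?B m) (C f)"
      unfolding TB by (rule hardy_inner_cmult_left[OF blaschke_power_hardy2 Cmem[OF f(1)]])
    ultimately show ?thesis using \<omega>_eq that(3,4) by auto
  qed
  have shift: "?T (\<lambda>z. b z * f z) = (\<lambda>z. \<omega> ^ Suc k * (b z * f z))"
    if "?T f = (\<lambda>z. \<omega> ^ k * f z)" for f k
  proof
    fix z
    show "?T (\<lambda>z. b z * f z) z = \<omega> ^ Suc k * (b z * f z)"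
      \<comment> \<open>Outside the disc the eigenvalue equation itself forces
        \<open>f z = 0\<close>, as \<open>\<omega>\<close> is nonzero.\<close>
      using fun_cong[OF that, of z] b\<phi>(1)[of z] \<omega>(1)
      by (auto simp: composition_op_def split: if_splits)
  qed

  \<comment> \<open>\<open>U v0\<close> and \<open>U v1\<close> represent evaluation and, up to a factor, differentiation at \<open>a\<close>; they span
    the corner of the Gram matrix.\<close>
  define v0 where "v0 = ?I"
  define v1 where "v1 = (\<lambda>z. z * ?I z + (- a) * ?I z)"
  have v: "v0 \<in> hardy2" "v1 \<in> hardy2"
    unfolding v0_def v1_def by (intro hardy2_add hardy2_cmult hardy2_shift indicator_hardy2)+
  have inner_v0: "hardy_inner f v0 = taylor_coeff f 0" if "f \<in> hardy2" for f
    unfolding v0_def by (rule hardy_inner_indicator[OF that])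
  have inner_v1: "hardy_inner f v1 = taylor_coeff f 1 - cnj a * taylor_coeff f 0" if "f \<in> hardy2" for f
  proof -
    have "hardy_inner f v1 = hardy_inner f (\<lambda>z. z * ?I z) + cnj (- a) * hardy_inner f ?I"
      unfolding v1_def using that
      by (simp only: hardy_inner_add_right hardy_inner_cmult_right hardy2_shift hardy2_cmult indicator_hardy2)
    then show ?thesis
      using hardy_inner_monomial[OF that, of 1] hardy_inner_indicator[OF that] by simp
  qed
  \<comment> \<open>The summand \<open>- a\<close> in \<open>v1\<close> produces exactly the
    correction term of \<open>taylor_coeff_comp_blaschke\<close> at index 1.\<close>
  have u0: "hardy_inner f (U v0) = s * taylor_coeff (composition_op b f) 0"
    and u1: "hardy_inner f (U v1) = s * taylor_coeff (composition_op b f) 1" if "f \<in> hardy2" for f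
    unfolding taylor_coeff_comp_blaschke[OF that] hardy_inner_flip_right[OF that v(1)]
      hardy_inner_flip_right[OF that v(2)]
    by (simp_all add: inner_v0 inner_v1 flip_hardy2 that)
  \<comment> \<open>\<open>U g\<close> represents a functional that \<open>?T\<close> multiplies by
    \<open>\<omega> ^ k\<close>, so it is an eigenvector of \<open>S\<close> for the conjugate
    eigenvalue; \<open>C\<close> carries it to an eigenvector of \<open>?T\<close>.\<close>
  have eig: "?T (C (U g)) = (\<lambda>z. \<omega> ^ k * C (U g) z)"
    if g: "g \<in> hardy2" and *: "\<And>f. f \<in> hardy2 \<Longrightarrow>
      hardy_inner f (U g) = s * taylor_coeff (composition_op b f) k" for g k
  proof -
    note Ug = flip_hardy2[OF g]
    have "S (U g) = (\<lambda>z. cnj (\<omega> ^ k) * U g z)"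
    proof (rule hardy2_eqI[OF S(1)[OF Ug] hardy2_cmult[OF Ug]])
      fix h assume h: "h \<in> hardy2"
      show "hardy_inner h (S (U g)) = hardy_inner h (\<lambda>z. cnj (\<omega> ^ k) * U g z)"
        using S(2)[OF h Ug] hardy_inner_cmult_right[OF Ug h, where c = "cnj (\<omega> ^ k)"]
          *[OF h] *[OF Tmem[OF h]] taylor_coeff_comp_blaschke_rotation[OF h \<omega>(1) \<phi>, of k]
        by (simp add: mult.left_commute)
    qed
    then have "?T (C (U g)) = C (\<lambda>z. cnj (\<omega> ^ k) * U g z)"
      using T[OF Cmem[OF Ug]] CC[OF Ug] by simp
    then show ?thesis unfolding Cmult[OF Ug] by simp
  qed
  note f0 = Cmem[OF flip_hardy2[OF v(1)]] and f1 = Cmem[OF flip_hardy2[OF v(2)]]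
  \<comment> \<open>\<open>C\<close> leads from \<open>F\<^sub>0\<close> to
    \<open>E\<^sub>0\<close>, multiplication by \<open>b\<close> to \<open>E\<^sub>1\<close>, and
    \<open>C\<close> back to \<open>F\<^sub>1\<close>; \<open>q\<close> arises likewise in
    \<open>F\<^sub>2\<close>. The two conjugations cancel, so \<open>p\<close> and \<open>q\<close>
    inherit the inner products of \<open>v0\<close> and \<open>v1\<close>.\<close>
  define p where "p = C (\<lambda>z. b z * C (U v0) z)"
  define q where "q = C (\<lambda>z. b z * C (U v1) z)"
  have E1: "?T (\<lambda>z. b z * C (U v0) z) = (\<lambda>z. \<omega> ^ 1 * (b z * C (U v0) z))"
    using shift[OF eig[OF v(1) u0]] by simp
  have E2: "?T (\<lambda>z. b z * C (U v1) z) = (\<lambda>z. \<omega> ^ 2 * (b z * C (U v1) z))"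
    using shift[OF eig[OF v(2) u1]] by (simp add: numeral_2_eq_2)
  have inner_bC: "hardy_inner (C (\<lambda>z. b z * C (U g) z)) (C (\<lambda>z. b z * C (U h) z)) = hardy_inner g h"
    if "g \<in> hardy2" "h \<in> hardy2" for g h
    using that by (simp add: inner_C hardy_inner_blaschke hardy2_blaschke_mult Cmem flip_hardy2 hardy_inner_flip)
  have coeff_v1: "taylor_coeff v1 0 = - a" "taylor_coeff v1 1 = 1"
    using hardy2D(1)[OF indicator_hardy2]
    by (simp_all only: v1_def taylor_coeff_add taylor_coeff_shift taylor_coeff_cmult
        hardy2D(1)[OF hardy2_shift[OF indicator_hardy2]] hardy2D(1)[OF hardy2_cmult[OF indicator_hardy2]])
      (simp_all add: taylor_coeff_indicator)
  have "a = 0"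
  proof (rule eigenvector_angle)
    show "p \<in> hardy2" "q \<in> hardy2"
      unfolding p_def q_def by (intro Cmem hardy2_blaschke_mult f0 f1)+
    show "hardy_inner (?B m) p = 0" if "m mod 3 \<noteq> 1" for m
      unfolding p_def using that by (intro orth[OF _ E1] hardy2_blaschke_mult f0) auto
    show "hardy_inner (?B m) q = 0" if "m mod 3 \<noteq> 2" for m
      unfolding q_def using that by (intro orth[OF _ E2] hardy2_blaschke_mult f1) auto
    show "hardy_inner p p = 1"
      unfolding p_def inner_bC[OF v(1) v(1)] inner_v0[OF v(1)] by (simp add: v0_def taylor_coeff_indicator)
    show "hardy_inner q q = 1 + a * cnj a"
      unfolding q_def inner_bC[OF v(2) v(2)] inner_v1[OF v(2)] coeff_v1 by simp
    show "hardy_inner p q = - cnj a"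
      unfolding p_def q_def inner_bC[OF v(1) v(2)] inner_v1[OF v(1)] by (simp add: v0_def taylor_coeff_indicator)
  qed
  with a show False by simp
qed

end

theorem theorem3p5:
  fixes \<phi> :: "complex \<Rightarrow> complex" and a :: complex
  assumes "elliptic_automorphism \<phi>"
    and "automorphism_order \<phi> = 3"
    and "a \<in> unit_disc - {0}"
    and "\<phi> a = a"
  shows "\<not> complex_symmetric_on hardy2 hardy_inner (composition_op \<phi>)"
proof -
  interpret disc_point a by standard (use assms(3) in simp)
  obtain \<omega> where \<omega>: "cmod \<omega> = 1" and \<phi>: "\<And>z. z \<in> unit_disc \<Longrightarrow> \<phi> (b z) = b (\<omega> * z)"
    using automorphism_conj_rotation assms(1,4) by (auto simp: elliptic_automorphism_def)
  let ?Q = "\<lambda>n. n > 0 \<and> (\<forall>z\<in>unit_disc. (\<phi> ^^ n) z = z)"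
  have ex: "\<exists>n. ?Q n" and least: "(LEAST n. ?Q n) = 3"
    using assms(2) by (auto simp: automorphism_order_def numeral_eq_enat split: if_splits)
  \<comment> \<open>Iterates become powers of \<open>\<omega>\<close>; evaluating at the nonzero
    point \<open>1/2\<close> and cancelling \<open>b\<close> then gives
    \<open>\<omega> ^ 3 = 1\<close>.\<close>
  have iter: "(\<phi> ^^ n) (b z) = b (\<omega> ^ n * z)" if "z \<in> unit_disc" for n z
  proof (induction n)
    case (Suc n)
    have "\<omega> ^ n * z \<in> unit_disc" using that \<omega> by (simp add: norm_mult norm_power)
    then show ?case using Suc \<phi> by (simp add: mult.assoc)
  qed simp
  have "?Q 3" using LeastI_ex[OF ex] unfolding least .
  moreover have half: "1/2 \<in> unit_disc" "\<omega> ^ 3 * (1/2) \<in> unit_disc"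
    using \<omega> by (simp_all add: norm_mult norm_power)
  ultimately have "b (\<omega> ^ 3 * (1/2)) = b (1/2)"
    using iter[OF half(1), of 3] blaschke_in_disc[OF half(1)] by simp
  then have "\<omega> ^ 3 * (1/2) = 1/2"
    using blaschke_blaschke[OF half(1)] blaschke_blaschke[OF half(2)] by simp
  then have "\<omega> ^ 3 = 1" by simp
  \<comment> \<open>Otherwise \<open>\<phi>\<close> is the identity on the disc, which has order
    1.\<close>
  moreover have "\<omega> \<noteq> 1"
  proof
    assume "\<omega> = 1"
    then have "\<phi> z = z" if "z \<in> unit_disc" for z
      using \<phi>[OF blaschke_in_disc[OF that]] blaschke_blaschke[OF that] by simp
    then have "?Q 1" by simp
    then show False using Least_le[of ?Q 1] least by simp
  qed
  ultimately show ?thesis using not_complex_symmetric[OF _ \<omega> _ _ \<phi>] assms(3) by blast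
qed
end
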